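(* Suppose there exist $\beta>0$ (with $\beta_x=\beta_y=\beta$), $\eta>0$ and a region $\mathcal R\subseteq\mathcal Z$ such that for all $z^*\in\mathcal Z^*$ the smoothed gap $G_\beta(\cdot;z^* )$ has a quadratic error bound with constant $\eta$ in the region $\mathcal R$ and with the norm $\|\cdot\|_V$, that is, for all $z\in\mathcal R$, $G_\beta(z;z^* )\ge\frac\eta2\mathrm{dist}_V(z,\mathcal Z^* )^2$. Let $a_2^+=\max(0,a_2)$. If the restart period $K\in\mathbb N$ satisfies $K\beta\ge2$ and $K\eta\ge2(2+a_2^+)$, then RAPDHG converges linearly at rate $2^{-1/K}$. Moreover, if $K=\lceil\max(2/\beta,\,2(2+a_2^+)/\eta)\rceil$, then the rate is $$\exp\Big(-\frac{1}{\lceil\max(2/\beta,\,2(2+a_2^+)/\eta)\rceil}\ln 2\Big)\approx\exp\Big(-\min\big(\beta/2,\ \eta/(2(2+a_2^+))\big)\ln 2\Big).$$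
   Context: Setting. $\mathcal X,\mathcal Y$ are real Hilbert spaces, $\mathcal Z=\mathcal X\times\mathcal Y$, $z=(x,y)$. $f,f_2:\mathcal X\to\mathbb R\cup\{+\infty\}$ and $g,g_2:\mathcal Y\to\mathbb R\cup\{+\infty\}$ are proper lower semicontinuous convex functions, $A:\mathcal X\to\mathcal Y$ is bounded linear, $f_2$ is differentiable with $L_f$-Lipschitz gradient and the conjugate $g_2^*$ is differentiable with $L_{g^*}$-Lipschitz gradient. The Lagrangian is $L(x,y)=f(x)+f_2(x)+\langle Ax,y\rangle-g^*(y)-g_2^*(y)$; its set of saddle points $\mathcal Z^*$ is assumed nonempty. Norm. For $\tau,\sigma>0$, $\|z\|_V=(\frac1\tau\|x\|^2+\frac1\sigma\|y\|^2)^{1/2}$; $\mathrm{dist}_V$ is the distance in this norm. Constants. $\gamma=\sigma\tau\|A\|^2$, $\alpha_f=\tau L_f/2$, $\alpha_g=\sigma L_{g^*}/2$; the step sizes satisfy $\gamma<1$, $\alpha_f<1$, $\alpha_g<1$; $a_2=\max\Big(\frac{2\alpha_f-1}{1-\alpha_f},\frac{2\alpha_g-1+\gamma}{1-\alpha_g-\gamma}\Big)$. Smoothed gap with $\beta_x=\beta_y=\beta$: $G_\beta(z;\dot z)=\sup_{z'\in\mathcal Z}L(x,y')-L(x',y)-\frac\beta2\|z'-\dot z\|_V^2$. APDHG$(z_0,K)$: starting from $z_0=(x_0,y_0)$, for $k=0,\dots,K-1$ compute $\bar x_{k+1}=\mathrm{prox}_{\tau f}(x_k-\tau\nabla f_2(x_k)-\tau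 A^\top y_k)$, $\bar y_{k+1}=\mathrm{prox}_{\sigma g^*}(y_k-\sigma\nabla g_2^*(y_k)+\sigma A\bar x_{k+1})$, $x_{k+1}=\bar x_{k+1}-\tau A^\top(\bar y_{k+1}-y_k)$, $y_{k+1}=\bar y_{k+1}$ (where $\mathrm{prox}_h(u)=\arg\min_{u'}h(u')+\frac12\|u-u'\|^2$), and return the average $\tilde z_K=\frac1K\sum_{l=1}^{K}\bar z_l$, where $\bar z_l=(\bar x_l,\bar y_l)$. RAPDHG: $z_0^R=z_0$ and $z_{s+1}^R=\mathrm{APDHG}(z_s^R,K)$ for $s\ge0$. A linear rate $r$ is counted per inner iteration and refers to the squared distance to the set of saddle points: $\mathrm{dist}_V(z_s^R,\mathcal Z^* )^2\le r^{sK}\,\mathrm{dist}_V(z_0,\mathcal Z^* )^2$ for all $s$, where $sK$ is the total number of inner iterations.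
   Formalization: The formal theorem additionally assumes 1-α_g-γ>0 (the denominator in a_2 is positive; the claim can fail if it is negative) and that the restart points z_s^R, s≥1, lie in the region R (otherwise R=∅ would make the error bound vacuous). *)

theory Defs
  imports "HOL-Analysis.Analysis"
begin

section \<open>Proper lower semicontinuous convex functions\<close>

definition proper :: "('a \<Rightarrow> ereal) \<Rightarrow> bool" where
  "proper h \<longleftrightarrow> (\<forall>u. h u \<noteq> -\<infinity>) \<and> (\<exists>u. h u \<noteq> \<infinity>)"

definition lsc :: "('a::topological_space \<Rightarrow> ereal) \<Rightarrow> bool" where
  "lsc h \<longleftrightarrow> (\<forall>u. h u \<le> Liminf (at u) h)"

text \<open>Only used together with \<open>proper\<close>, so that the right-hand side is never
  \<open>\<infinity> - \<infinity>\<close>; at the endpoints of the segment \<open>0 * \<infinity> = 0\<close> in \<open>ereal\<close>.\<close>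

definition ereal_convex :: "('a::real_vector \<Rightarrow> ereal) \<Rightarrow> bool" where
  "ereal_convex h \<longleftrightarrow> (\<forall>u v. \<forall>t\<in>{0..1}.
     h ((1 - t) *\<^sub>R u + t *\<^sub>R v) \<le> ereal (1 - t) * h u + ereal t * h v)"

definition proper_lsc_convex :: "('a::real_normed_vector \<Rightarrow> ereal) \<Rightarrow> bool" where
  "proper_lsc_convex h \<longleftrightarrow> proper h \<and> lsc h \<and> ereal_convex h"

definition conjugate :: "('a::real_inner \<Rightarrow> ereal) \<Rightarrow> 'a \<Rightarrow> ereal" where
  "conjugate h v = (SUP u. ereal (u \<bullet> v) - h u)"

text \<open>\<open>h\<close> is finite and differentiable on the whole space, \<open>dh\<close> is its gradient, and \<open>dh\<close> is
  Lipschitz continuous with constant \<open>C\<close>.\<close>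

definition has_lipschitz_gradient ::
  "('a::real_inner \<Rightarrow> ereal) \<Rightarrow> ('a \<Rightarrow> 'a) \<Rightarrow> real \<Rightarrow> bool" where
  "has_lipschitz_gradient h dh C \<longleftrightarrow>
     (\<forall>u. \<bar>h u\<bar> \<noteq> \<infinity>) \<and>
     (\<forall>u. GDERIV (\<lambda>v. real_of_ereal (h v)) u :> dh u) \<and>
     C-lipschitz_on UNIV dh"

definition prox :: "('a::real_inner \<Rightarrow> ereal) \<Rightarrow> 'a \<Rightarrow> 'a" where
  "prox h u = arg_min (\<lambda>v. h v + ereal ((norm (u - v))\<^sup>2 / 2)) (\<lambda>_. True)"

section \<open>Saddle points and the smoothed gap\<close>

text \<open>The library's \<open>ereal\<close> convention is \<open>\<infinity> - \<infinity> = \<infinity>\<close>. Hence the Lagrangian is \<open>\<infinity>\<close> outside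
  the domain of \<open>f + f\<^sub>2\<close>, and \<open>-\<infinity>\<close> when only the dual variable is outside its domain. With
  this convention, \<open>smoothed_gap\<close> below is the supremum over \<open>z'\<close> in the product of the two
  domains if \<open>z\<close> is in that product, and \<open>\<infinity>\<close> otherwise.\<close>

definition lagrangian ::
  "('x::real_inner \<Rightarrow> ereal) \<Rightarrow> ('x \<Rightarrow> ereal) \<Rightarrow> ('y::real_inner \<Rightarrow> ereal) \<Rightarrow> ('y \<Rightarrow> ereal) \<Rightarrow>
   ('x \<Rightarrow> 'y) \<Rightarrow> 'x \<Rightarrow> 'y \<Rightarrow> ereal" where
  "lagrangian f f2 g g2 A x y =
     f x + f2 x + ereal (A x \<bullet> y) - conjugate g y - conjugate g2 y"

definition saddle_points :: "('x \<Rightarrow> 'y \<Rightarrow> ereal) \<Rightarrow> ('x \<times> 'y) set" where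
  "saddle_points L = {(x, y). \<forall>x' y'. L x y' \<le> L x y \<and> L x y \<le> L x' y}"

definition normV ::
  "real \<Rightarrow> real \<Rightarrow> 'x::real_normed_vector \<times> 'y::real_normed_vector \<Rightarrow> real" where
  "normV \<tau> \<sigma> z = sqrt ((norm (fst z))\<^sup>2 / \<tau> + (norm (snd z))\<^sup>2 / \<sigma>)"

definition distV ::
  "real \<Rightarrow> real \<Rightarrow> 'x::real_normed_vector \<times> 'y::real_normed_vector \<Rightarrow> ('x \<times> 'y) set \<Rightarrow> real" where
  "distV \<tau> \<sigma> z S = (INF w\<in>S. normV \<tau> \<sigma> (z - w))"

definition smoothed_gap ::
  "real \<Rightarrow> real \<Rightarrow> ('x::real_normed_vector \<Rightarrow> 'y::real_normed_vector \<Rightarrow> ereal) \<Rightarrow> real \<Rightarrow>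
   'x \<times> 'y \<Rightarrow> 'x \<times> 'y \<Rightarrow> ereal" where
  "smoothed_gap \<tau> \<sigma> L \<beta> z zc =
     (SUP z'. L (fst z) (snd z') - L (fst z') (snd z) - ereal (\<beta> / 2 * (normV \<tau> \<sigma> (z' - zc))\<^sup>2))"

definition quadratic_error_bound ::
  "real \<Rightarrow> real \<Rightarrow> ('x::real_normed_vector \<times> 'y::real_normed_vector \<Rightarrow> ereal) \<Rightarrow>
   ('x \<times> 'y) set \<Rightarrow> real \<Rightarrow> ('x \<times> 'y) set \<Rightarrow> bool" where
  "quadratic_error_bound \<tau> \<sigma> G S \<eta> R \<longleftrightarrow>
     (\<forall>z\<in>R. G z \<ge> ereal (\<eta> / 2 * (distV \<tau> \<sigma> z S)\<^sup>2))"

section \<open>The algorithms\<close>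

text \<open>\<open>df2\<close> is the gradient of \<open>f2\<close>, \<open>gs\<close> the conjugate of \<open>g\<close> and \<open>dgs2\<close> the gradient of the
  conjugate of \<open>g2\<close>. One iteration from \<open>z\<close> first computes \<open>pdhg_bar\<close>, then \<open>pdhg_step\<close>.\<close>

definition pdhg_bar ::
  "real \<Rightarrow> real \<Rightarrow> ('x::real_inner \<Rightarrow> ereal) \<Rightarrow> ('x \<Rightarrow> 'x) \<Rightarrow>
   ('y::real_inner \<Rightarrow> ereal) \<Rightarrow> ('y \<Rightarrow> 'y) \<Rightarrow> ('x \<Rightarrow> 'y) \<Rightarrow> 'x \<times> 'y \<Rightarrow> 'x \<times> 'y" where
  "pdhg_bar \<tau> \<sigma> f df2 gs dgs2 A z =
     (let x = fst z; y = snd z;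
          xb = prox (\<lambda>u. ereal \<tau> * f u) (x - \<tau> *\<^sub>R df2 x - \<tau> *\<^sub>R adjoint A y);
          yb = prox (\<lambda>v. ereal \<sigma> * gs v) (y - \<sigma> *\<^sub>R dgs2 y + \<sigma> *\<^sub>R A xb)
      in (xb, yb))"

definition pdhg_step ::
  "real \<Rightarrow> real \<Rightarrow> ('x::real_inner \<Rightarrow> ereal) \<Rightarrow> ('x \<Rightarrow> 'x) \<Rightarrow>
   ('y::real_inner \<Rightarrow> ereal) \<Rightarrow> ('y \<Rightarrow> 'y) \<Rightarrow> ('x \<Rightarrow> 'y) \<Rightarrow> 'x \<times> 'y \<Rightarrow> 'x \<times> 'y" where
  "pdhg_step \<tau> \<sigma> f df2 gs dgs2 A z =
     (let (xb, yb) = pdhg_bar \<tau> \<sigma> f df2 gs dgs2 A z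
      in (xb - \<tau> *\<^sub>R adjoint A (yb - snd z), yb))"

definition apdhg ::
  "real \<Rightarrow> real \<Rightarrow> ('x::real_inner \<Rightarrow> ereal) \<Rightarrow> ('x \<Rightarrow> 'x) \<Rightarrow>
   ('y::real_inner \<Rightarrow> ereal) \<Rightarrow> ('y \<Rightarrow> 'y) \<Rightarrow> ('x \<Rightarrow> 'y) \<Rightarrow> nat \<Rightarrow> 'x \<times> 'y \<Rightarrow> 'x \<times> 'y" where
  "apdhg \<tau> \<sigma> f df2 gs dgs2 A K z0 =
     (1 / real K) *\<^sub>R
       (\<Sum>k<K. pdhg_bar \<tau> \<sigma> f df2 gs dgs2 A ((pdhg_step \<tau> \<sigma> f df2 gs dgs2 A ^^ k) z0))"

definition rapdhg ::
  "real \<Rightarrow> real \<Rightarrow> ('x::real_inner \<Rightarrow> ereal) \<Rightarrow> ('x \<Rightarrow> 'x) \<Rightarrow>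
   ('y::real_inner \<Rightarrow> ereal) \<Rightarrow> ('y \<Rightarrow> 'y) \<Rightarrow> ('x \<Rightarrow> 'y) \<Rightarrow> nat \<Rightarrow> 'x \<times> 'y \<Rightarrow> nat \<Rightarrow> 'x \<times> 'y" where
  "rapdhg \<tau> \<sigma> f df2 gs dgs2 A K z0 s = (apdhg \<tau> \<sigma> f df2 gs dgs2 A K ^^ s) z0"

text \<open>Rate \<open>r\<close> per inner iteration, for the squared distance; \<open>zR s\<close> is reached after
  \<open>s * K\<close> inner iterations.\<close>

definition converges_linearly ::
  "real \<Rightarrow> real \<Rightarrow> ('x::real_normed_vector \<times> 'y::real_normed_vector) set \<Rightarrow> nat \<Rightarrow>
   (nat \<Rightarrow> 'x \<times> 'y) \<Rightarrow> real \<Rightarrow> bool" where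
  "converges_linearly \<tau> \<sigma> S K zR r \<longleftrightarrow>
     (\<forall>s. (distV \<tau> \<sigma> (zR s) S)\<^sup>2 \<le> r ^ (s * K) * (distV \<tau> \<sigma> (zR 0) S)\<^sup>2)"

end

theory Submission
  imports Defs
begin

text \<open>One iteration satisfies two estimates. For every \<open>z\<close> in the domain, the variational inequalities
  of the two proximal steps and the descent lemma bound \<open>2 (L(xb, y) - L(x, yb))\<close> by
  \<open>\<parallel>z\<^sub>k - z\<parallel>\<^sup>2 - \<parallel>z\<^sub>k\<^sub>+\<^sub>1 - z\<parallel>\<^sup>2\<close> plus residual terms whose coefficients may be positive. For
  a saddle point \<open>z*\<close>, cocoercivity of the gradients yields
  \<open>\<parallel>z\<^sub>k\<^sub>+\<^sub>1 - z*\<parallel>\<^sup>2 \<le> \<parallel>z\<^sub>k - z*\<parallel>\<^sup>2\<close> minus the same residuals with positive coefficients, and \<open>a2p\<close>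
  times this estimate compensates the first one. Summing over \<open>K\<close> iterations and using convexity, the
  smoothed gap of the average centred at \<open>z*\<close> is at most \<open>(2 + a2p) / (2 K) * \<parallel>z\<^sub>0 - z*\<parallel>\<^sup>2\<close> once
  \<open>K * \<beta> \<ge> 2\<close>. By the error bound, the squared distance to the saddle points is halved when moreover
  \<open>K * \<eta> \<ge> 2 (2 + a2p)\<close>.\<close>

section \<open>Convex functions with values in the extended reals\<close>

text \<open>The punctured neighbourhoods of \<open>lsc\<close> can be completed, since
  \<open>c < h p\<close> holds at \<open>p\<close> itself. Every later argument about lower
  semicontinuity uses this form.\<close>

lemma lsc_iff_eventually:
  "lsc h \<longleftrightarrow> (\<forall>p c. c < h p \<longrightarrow> (\<forall>\<^sub>F v in nhds p. c < h v))"
  unfolding lsc_def le_Liminf_iff eventually_nhds_conv_at by blast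

lemma convex_on_combination:
  assumes "convex_on D r" "u \<in> D" "v \<in> D" "0 \<le> t" "t \<le> 1"
  shows "(1 - t) *\<^sub>R u + t *\<^sub>R v \<in> D"
    and "r ((1 - t) *\<^sub>R u + t *\<^sub>R v) \<le> (1 - t) * r u + t * r v"
  using convex_onD[OF assms(1,4,5,2,3)] convexD_alt[OF convex_on_imp_convex[OF assms(1)] assms(2-5)]
  by auto

text \<open>Separates an extended-real convex function into its effective domain and a real function
  on it, so that the estimates can be made in the reals. The values of \<open>r\<close> off
  \<open>D\<close> are arbitrary.\<close>

definition domain_repr :: "('a::real_normed_vector \<Rightarrow> ereal) \<Rightarrow> 'a set \<Rightarrow> ('a \<Rightarrow> real) \<Rightarrow> bool" where
  "domain_repr h D r \<longleftrightarrow> D \<noteq> {} \<and> convex_on D r \<and> (\<forall>v. h v = (if v \<in> D then ereal (r v) else \<infinity>))"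

lemma proper_convex_repr:
  assumes "proper h" "ereal_convex h"
  shows "domain_repr h {v. h v \<noteq> \<infinity>} (\<lambda>v. real_of_ereal (h v))"
proof -
  let ?D = "{v. h v \<noteq> \<infinity>}" and ?r = "\<lambda>v. real_of_ereal (h v)"
  have fin: "h v = ereal (?r v)" if "v \<in> ?D" for v
    using that assms(1) by (cases "h v") (auto simp: proper_def)
  have conv: "h ((1 - t) *\<^sub>R u + t *\<^sub>R v) \<le> ereal ((1 - t) * ?r u + t * ?r v)"
    if "u \<in> ?D" "v \<in> ?D" "t \<in> {0..1}" for u v t
  proof -
    have "h ((1 - t) *\<^sub>R u + t *\<^sub>R v) \<le> ereal (1 - t) * h u + ereal t * h v"
      using assms(2) that(3) by (auto simp: ereal_convex_def)
    then show ?thesis by (subst (asm) fin[OF that(1)], subst (asm) fin[OF that(2)]) simp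
  qed
  have conv': "(1 - t) *\<^sub>R u + t *\<^sub>R v \<in> ?D \<and> ?r ((1 - t) *\<^sub>R u + t *\<^sub>R v) \<le> (1 - t) * ?r u + t * ?r v"
    if "u \<in> ?D" "v \<in> ?D" "t \<in> {0..1}" for u v t
  proof -
    have "(1 - t) *\<^sub>R u + t *\<^sub>R v \<in> ?D" using conv[OF that] by auto
    with conv[OF that] fin[of "(1 - t) *\<^sub>R u + t *\<^sub>R v"] show ?thesis
      by (metis ereal_less_eq(3))
  qed
  have "convex ?D"
    unfolding convex_alt using conv' by auto
  then have "convex_on ?D ?r"
    using conv' by (intro convex_onI) auto
  moreover have "?D \<noteq> {}" using assms(1) by (auto simp: proper_def)
  ultimately show ?thesis unfolding domain_repr_def using fin by auto
qed

lemma domain_repr_imp: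
  assumes "domain_repr h D r"
  shows "proper h" "ereal_convex h"
proof -
  show "proper h" using assms by (auto simp: domain_repr_def proper_def)
  have cv: "convex_on D r" using assms by (simp add: domain_repr_def)
  show "ereal_convex h"
    unfolding ereal_convex_def
  proof (intro allI ballI)
    fix u v and t :: real assume t: "t \<in> {0..1}"
    \<comment> \<open>At \<open>t = 0\<close> and \<open>t = 1\<close>,
      \<open>0 * \<infinity> = 0\<close> reduces the claim to an equality. Strictly between, a point
      \<open>u\<close> or \<open>v\<close> off \<open>D\<close> makes the right-hand side
      infinite.\<close>
    consider "t = 0" | "t = 1" | "0 < t" "t < 1" using t by fastforce
    then show "h ((1 - t) *\<^sub>R u + t *\<^sub>R v) \<le> ereal (1 - t) * h u + ereal t * h v"
    proof cases
      case 3
      show ?thesis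
      proof (cases "u \<in> D \<and> v \<in> D")
        case True
        then have "(1 - t) *\<^sub>R u + t *\<^sub>R v \<in> D" "r ((1 - t) *\<^sub>R u + t *\<^sub>R v) \<le> (1 - t) * r u + t * r v"
          using 3 True by (auto intro: convex_on_combination[OF cv])
        then show ?thesis using assms True by (simp add: domain_repr_def)
      next
        case False
        then show ?thesis using assms 3 by (auto simp: domain_repr_def)
      qed
    qed (simp_all flip: zero_ereal_def one_ereal_def)
  qed
qed

lemma proper_lsc_convexE:
  assumes "proper_lsc_convex h"
  obtains D r where "domain_repr h D r" "lsc h"
  using assms proper_convex_repr unfolding proper_lsc_convex_def by blast

lemma proper_lsc_convex_scale:
  assumes "proper_lsc_convex h" "\<tau> > 0"
  shows "proper_lsc_convex (\<lambda>u. ereal \<tau> * h u)"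
proof -
  obtain D r where D: "domain_repr h D r" and l: "lsc h" using assms proper_lsc_convexE by blast
  have "domain_repr (\<lambda>u. ereal \<tau> * h u) D (\<lambda>v. \<tau> * r v)"
    using D assms(2) by (auto simp: domain_repr_def intro: convex_on_cmul)
  moreover have "lsc (\<lambda>u. ereal \<tau> * h u)"
    unfolding lsc_iff_eventually
  proof (intro allI impI)
    fix p and c :: ereal assume c: "c < ereal \<tau> * h p"
    have eq: "c < ereal \<tau> * x \<longleftrightarrow> c / ereal \<tau> < x" for x
      using assms(2) by (subst ereal_divide_less_iff) (auto simp: mult.commute)
    show "\<forall>\<^sub>F v in nhds p. c < ereal \<tau> * h v"
      using l c unfolding lsc_iff_eventually eq by blast
  qed
  ultimately show ?thesis using domain_repr_imp by (auto simp: proper_lsc_convex_def)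
qed

section \<open>Proximal points\<close>

text \<open>Lower semicontinuity bounds \<open>h\<close> from below near a point of its domain, and convexity
  propagates this bound along rays; thus no separation theorem is needed.\<close>

lemma proper_lsc_convex_minorant:
  fixes h :: "'a::real_normed_vector \<Rightarrow> ereal"
  assumes "proper_lsc_convex h"
  shows "\<exists>a b u0. 0 \<le> b \<and> (\<forall>v. ereal (a - b * norm (v - u0)) \<le> h v)"
proof -
  obtain D r where D: "domain_repr h D r" and l: "lsc h" using assms proper_lsc_convexE by blast
  then obtain u0 where u0: "u0 \<in> D" by (auto simp: domain_repr_def)
  have hD: "h v = ereal (r v)" if "v \<in> D" for v using D that by (simp add: domain_repr_def)
  have "ereal (r u0 - 1) < h u0" using hD[OF u0] by simp
  then have "\<forall>\<^sub>F v in nhds u0. ereal (r u0 - 1) < h v" using l unfolding lsc_iff_eventually by blast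
  then obtain d where d: "d > 0" "\<And>v. dist v u0 < d \<Longrightarrow> ereal (r u0 - 1) < h v"
    by (auto simp: eventually_nhds_metric)
  define e where "e = d / 2"
  have e: "e > 0" "e < d" using d by (auto simp: e_def)
  have "ereal (r u0 - 1 - (1 / e) * norm (v - u0)) \<le> h v" for v
  proof (cases "v \<in> D")
    case False
    then show ?thesis using D by (simp add: domain_repr_def)
  next
    case True
    show ?thesis
    proof (cases "norm (v - u0) < d")
      case True
      then have "ereal (r u0 - 1) < h v" using d(2) by (simp add: dist_norm)
      moreover have "ereal (r u0 - 1 - (1 / e) * norm (v - u0)) \<le> ereal (r u0 - 1)" using e by simp
      ultimately show ?thesis by (meson less_imp_le order_trans)
    next
      case False
      define n where "n = norm (v - u0)"
      \<comment> \<open>This puts \<open>w\<close> on the segment from \<open>u0\<close> to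
        \<open>v\<close> at distance \<open>e < d\<close> from \<open>u0\<close>, where the local
        bound on \<open>h\<close> is available.\<close>
      define t where "t = e / n"
      have n: "n \<ge> d" "n > 0" using False d by (auto simp: n_def)
      have t: "0 < t" "t < 1" using n e by (auto simp: t_def)
      define w where "w = (1 - t) *\<^sub>R u0 + t *\<^sub>R v"
      have "w - u0 = t *\<^sub>R (v - u0)" by (simp add: w_def algebra_simps)
      then have "norm (w - u0) = t * n" using t by (simp add: n_def)
      then have "norm (w - u0) < d" using n e by (simp add: t_def)
      then have "ereal (r u0 - 1) < h w" using d(2) by (simp add: dist_norm)
      moreover have "w \<in> D" "r w \<le> (1 - t) * r u0 + t * r v"
        using D u0 \<open>v \<in> D\<close> t convex_on_combination[of D r u0 v t] by (auto simp: domain_repr_def w_def)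
      ultimately have "r u0 - 1 < (1 - t) * r u0 + t * r v" using hD by simp
      then have "t * (r u0 - r v) < 1" by (simp add: algebra_simps)
      then have "r u0 - r v < 1 / t" using t by (simp add: field_simps)
      also have "1 / t = (1 / e) * n" by (simp add: t_def)
      finally show ?thesis using hD[OF \<open>v \<in> D\<close>] by (simp add: n_def)
    qed
  qed
  then show ?thesis using e by (intro exI[of _ "r u0 - 1"] exI[of _ "1 / e"] exI[of _ u0]) auto
qed

text \<open>The quadratic term makes the objective strongly convex, so a minimising sequence is
  Cauchy; completeness gives a limit, and lower semicontinuity makes it a minimiser.\<close>

lemma prox_minimiser_exists:
  fixes h :: "'a::{real_inner,banach} \<Rightarrow> ereal"
  assumes "proper_lsc_convex h"
  shows "\<exists>p. \<forall>v. h p + ereal ((norm (u - p))\<^sup>2 / 2) \<le> h v + ereal ((norm (u - v))\<^sup>2 / 2)"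
proof -
  obtain D r where D: "domain_repr h D r" and l: "lsc h" using assms proper_lsc_convexE by blast
  have hD: "h v = ereal (r v)" if "v \<in> D" for v using D that by (simp add: domain_repr_def)
  have Dne: "D \<noteq> {}" and cv: "convex_on D r" using D by (auto simp: domain_repr_def)
  define \<phi> where "\<phi> v = r v + (norm (u - v))\<^sup>2 / 2" for v
  obtain a b u0 where b: "0 \<le> b" and low: "\<And>v. ereal (a - b * norm (v - u0)) \<le> h v"
    using proper_lsc_convex_minorant[OF assms] by blast
  \<comment> \<open>Completing the square: the quadratic term absorbs the linear decrease of the
    minorant at a cost of at most \<open>b\<^sup>2 / 2\<close>.\<close>
  have lowD: "a - b * norm (u - u0) - b\<^sup>2 / 2 \<le> \<phi> v" if "v \<in> D" for v
  proof -
    have "a - b * norm (v - u0) \<le> r v" using low[of v] hD[OF that] by simp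
    moreover have "norm (v - u0) \<le> norm (u - v) + norm (u - u0)"
      using norm_triangle_ineq4[of "u - u0" "u - v"] by (simp add: algebra_simps)
    then have "b * norm (v - u0) \<le> b * norm (u - v) + b * norm (u - u0)"
      using mult_left_mono[OF _ b] by (metis distrib_left)
    moreover have "0 \<le> (norm (u - v) - b)\<^sup>2" by simp
    ultimately show ?thesis by (simp add: \<phi>_def power2_diff algebra_simps)
  qed
  have bdd: "bdd_below (\<phi> ` D)" using lowD by (meson bdd_belowI2)
  define m where "m = (INF v\<in>D. \<phi> v)"
  have m: "m \<le> \<phi> v" if "v \<in> D" for v unfolding m_def using bdd that by (rule cINF_lower)
  have "\<exists>v\<in>D. \<phi> v < m + 1 / real (Suc n)" for n
    using cINF_less_iff[OF Dne bdd, of "m + 1 / real (Suc n)"] by (simp add: m_def)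
  then obtain v where v: "\<And>n. v n \<in> D" "\<And>n. \<phi> (v n) < m + 1 / real (Suc n)" by metis
  \<comment> \<open>The parallelogram law at the midpoint \<open>w\<close>, whose value is at least
    the infimum \<open>m\<close>: two almost optimal points are close to each other.\<close>
  have mid: "(norm (p - q))\<^sup>2 \<le> 4 * (\<phi> p + \<phi> q - 2 * m)" if "p \<in> D" "q \<in> D" for p q
  proof -
    define w where "w = (1 - 1 / 2) *\<^sub>R p + (1 / 2) *\<^sub>R q"
    have "w \<in> D" "r w \<le> (1 - 1 / 2) * r p + (1 / 2) * r q"
      unfolding w_def by (rule convex_on_combination[OF cv that]; simp)+
    then have 1: "m \<le> r p / 2 + r q / 2 + (norm (u - w))\<^sup>2 / 2" using m[of w] by (simp add: \<phi>_def)
    have "4 * (norm (u - w))\<^sup>2 = (norm (2 *\<^sub>R (u - w)))\<^sup>2" by (simp add: power_mult_distrib)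
    also have "2 *\<^sub>R (u - w) = (u - p) + (u - q)" by (simp add: w_def scaleR_right_diff_distrib scaleR_add_right scaleR_2)
    also have "(norm ((u - p) + (u - q)))\<^sup>2 = 2 * (norm (u - p))\<^sup>2 + 2 * (norm (u - q))\<^sup>2 - (norm (p - q))\<^sup>2"
      by (simp add: power2_norm_eq_inner inner_diff_left inner_diff_right inner_add_left inner_add_right
          inner_commute algebra_simps)
    finally show ?thesis using 1 by (simp add: \<phi>_def)
  qed
  have "Cauchy v"
    unfolding Cauchy_altdef2
  proof (intro allI impI)
    fix e :: real assume e: "e > 0"
    \<comment> \<open>From index \<open>N\<close> on, both values in \<open>mid\<close> exceed
      \<open>m\<close> by less than \<open>1 / Suc N\<close>, which bounds the squared distance by
      \<open>8 / Suc N\<close>.\<close>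
    then obtain N where "8 / e\<^sup>2 < real N" using reals_Archimedean2 by blast
    then have N: "8 / e\<^sup>2 < real (Suc N)" by simp
    have "dist (v n) (v N) < e" if "n \<ge> N" for n
    proof -
      have "1 / real (Suc n) \<le> 1 / real (Suc N)" using that by (simp add: frac_le)
      then have "(norm (v n - v N))\<^sup>2 < 4 * (2 / real (Suc N))"
        using mid[OF v(1) v(1), of n N] v(2)[of n] v(2)[of N] by simp
      also have "\<dots> < e\<^sup>2" using N e by (simp add: field_simps)
      finally show ?thesis using e by (simp add: dist_norm power_less_imp_less_base)
    qed
    then show "\<exists>N. \<forall>n\<ge>N. dist (v n) (v N) < e" by blast
  qed
  then obtain p where p: "v \<longlonglongrightarrow> p" using Cauchy_convergent convergent_def by blast
  have lim0: "(\<lambda>n. m + 1 / real (Suc n)) \<longlonglongrightarrow> m"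
    using tendsto_add[OF tendsto_const LIMSEQ_inverse_real_of_nat, of m] by (simp add: inverse_eq_divide)
  \<comment> \<open>Otherwise a real \<open>c\<close> fits strictly between the two sides. By lower
    semicontinuity \<open>c\<close> is eventually below \<open>h (v n)\<close>, and the limit of the
    objective values contradicts the choice of \<open>c\<close>.\<close>
  have "h p \<le> ereal (m - (norm (u - p))\<^sup>2 / 2)"
  proof (rule ccontr)
    assume "\<not> ?thesis"
    then obtain c where c: "ereal (m - (norm (u - p))\<^sup>2 / 2) < ereal c" "ereal c < h p"
      using ereal_dense2[of "ereal (m - (norm (u - p))\<^sup>2 / 2)" "h p"] by (auto simp: not_le)
    then have "\<forall>\<^sub>F w in nhds p. ereal c < h w" using l unfolding lsc_iff_eventually by blast
    then have "\<forall>\<^sub>F n in sequentially. ereal c < h (v n)"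
      using p by (auto simp: filterlim_iff)
    then have ev: "\<forall>\<^sub>F n in sequentially. c + (norm (u - v n))\<^sup>2 / 2 \<le> m + 1 / real (Suc n)"
    proof eventually_elim
      case (elim n)
      then show ?case using v(2)[of n] hD[OF v(1)[of n]] by (simp add: \<phi>_def)
    qed
    have "(\<lambda>n. c + (norm (u - v n))\<^sup>2 / 2) \<longlonglongrightarrow> c + (norm (u - p))\<^sup>2 / 2"
      by (intro tendsto_intros p) simp
    then have "c + (norm (u - p))\<^sup>2 / 2 \<le> m"
      using tendsto_le[OF _ lim0 _ ev] by simp
    with c(1) show False by simp
  qed
  then have hp: "h p + ereal ((norm (u - p))\<^sup>2 / 2) \<le> ereal m"
    using add_right_mono[of "h p" "ereal (m - (norm (u - p))\<^sup>2 / 2)" "ereal ((norm (u - p))\<^sup>2 / 2)"] by simp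
  have "ereal m \<le> h w + ereal ((norm (u - w))\<^sup>2 / 2)" for w
    using m[of w] D by (cases "w \<in> D") (auto simp: domain_repr_def \<phi>_def)
  then show ?thesis using hp order_trans by blast
qed

text \<open>Along the segment from \<open>p\<close> to \<open>x\<close> the error term is of second order, so it vanishes.\<close>

lemma convex_on_tangent_minorant:
  fixes h :: "'a::real_inner \<Rightarrow> real"
  assumes cv: "convex_on D h" and p: "p \<in> D" and x: "x \<in> D"
    and minor: "\<And>v. v \<in> D \<Longrightarrow> h p + q \<bullet> (v - p) \<le> h v + C * (norm (v - p))\<^sup>2"
  shows "h p + q \<bullet> (x - p) \<le> h x"
proof -
  define c where "c = C * (norm (x - p))\<^sup>2"
  have ineq: "h p + q \<bullet> (x - p) \<le> h x + t * c" if t: "0 < t" "t \<le> 1" for t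
  proof -
    define w where "w = (1 - t) *\<^sub>R p + t *\<^sub>R x"
    have w: "w \<in> D" "h w \<le> (1 - t) * h p + t * h x"
      using t convex_on_combination[OF cv p x] by (auto simp: w_def)
    have wp: "w - p = t *\<^sub>R (x - p)" by (simp add: w_def algebra_simps)
    have "h p + t * (q \<bullet> (x - p)) \<le> (1 - t) * h p + t * h x + t * t * c"
      using minor[OF w(1)] w(2) unfolding wp
      by (simp add: c_def power_mult_distrib power2_eq_square mult_ac)
    then have "t * (h p + q \<bullet> (x - p)) \<le> t * (h x + t * c)" by (simp add: algebra_simps)
    then show ?thesis using t by simp
  qed
  have "((\<lambda>t. h x + t * c) \<longlongrightarrow> h x + 0 * c) (at_right 0)"
    by (intro tendsto_intros)
  moreover have "\<forall>\<^sub>F t in at_right 0. h p + q \<bullet> (x - p) \<le> h x + t * c"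
    unfolding eventually_at_right_field by (intro exI[of _ 1]) (auto intro: ineq)
  ultimately show ?thesis
    using tendsto_lowerbound[of "\<lambda>t. h x + t * c" "h x" "at_right (0::real)"] by simp
qed

text \<open>Expanding the square turns minimality into a tangent inequality with a quadratic error,
  which \<open>convex_on_tangent_minorant\<close> removes. Thus \<open>u - p\<close> is a
  subgradient at \<open>p\<close>.\<close>

lemma prox_minimiser_variational:
  fixes h :: "'a::real_inner \<Rightarrow> ereal"
  assumes D: "domain_repr h D r"
    and min: "\<And>v. h p + ereal ((norm (u - p))\<^sup>2 / 2) \<le> h v + ereal ((norm (u - v))\<^sup>2 / 2)"
  shows "p \<in> D" "v \<in> D \<Longrightarrow> r p + (u - p) \<bullet> (v - p) \<le> r v"
proof -
  have hD: "h v = ereal (r v)" if "v \<in> D" for v using D that by (simp add: domain_repr_def)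
  obtain w where "w \<in> D" using D by (auto simp: domain_repr_def)
  then show p: "p \<in> D" using min[of w] D by (auto simp: domain_repr_def split: if_splits)
  assume v: "v \<in> D"
  show "r p + (u - p) \<bullet> (v - p) \<le> r v"
  proof (rule convex_on_tangent_minorant[where D = D and C = "1/2"])
    fix w assume "w \<in> D"
    then have "r p + (norm (u - p))\<^sup>2 / 2 \<le> r w + (norm (u - w))\<^sup>2 / 2"
      using min[of w] hD p by simp
    moreover have "(norm (u - w))\<^sup>2 = (norm (u - p))\<^sup>2 - 2 * ((u - p) \<bullet> (w - p)) + (norm (w - p))\<^sup>2"
      by (simp add: power2_norm_eq_inner inner_diff_left inner_diff_right inner_commute algebra_simps)
    ultimately show "r p + (u - p) \<bullet> (w - p) \<le> r w + 1 / 2 * (norm (w - p))\<^sup>2" by argo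
  qed (use D v p in \<open>auto simp: domain_repr_def\<close>)
qed

text \<open>Existence of a minimiser is what makes the choice behind \<open>arg_min\<close> return
  one.\<close>

lemma prox_minimises:
  fixes h :: "'a::{real_inner,banach} \<Rightarrow> ereal"
  assumes "proper_lsc_convex h"
  shows "h (prox h u) + ereal ((norm (u - prox h u))\<^sup>2 / 2) \<le> h v + ereal ((norm (u - v))\<^sup>2 / 2)"
proof -
  have "\<exists>p. is_arg_min (\<lambda>v. h v + ereal ((norm (u - v))\<^sup>2 / 2)) (\<lambda>_. True) p"
    using prox_minimiser_exists[OF assms, of u] by (auto simp: is_arg_min_def not_less)
  then have "is_arg_min (\<lambda>v. h v + ereal ((norm (u - v))\<^sup>2 / 2)) (\<lambda>_. True) (prox h u)"
    unfolding prox_def arg_min_def by (rule someI_ex)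
  then show ?thesis by (auto simp: is_arg_min_def not_less)
qed

lemma prox_scaled_variational:
  fixes h :: "'a::{real_inner,banach} \<Rightarrow> ereal" and u :: 'a
  assumes "proper_lsc_convex h" "domain_repr h D r" "\<tau> > 0"
  defines "p \<equiv> prox (\<lambda>v. ereal \<tau> * h v) u"
  shows "p \<in> D" "v \<in> D \<Longrightarrow> r p + ((u - p) \<bullet> (v - p)) / \<tau> \<le> r v"
proof -
  have D: "domain_repr (\<lambda>v. ereal \<tau> * h v) D (\<lambda>v. \<tau> * r v)"
    using assms(2,3) by (auto simp: domain_repr_def intro: convex_on_cmul)
  note min = prox_minimises[OF proper_lsc_convex_scale[OF assms(1,3)], of u, folded p_def]
  show "p \<in> D" using prox_minimiser_variational(1)[OF D min] .
  assume "v \<in> D"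
  then have "\<tau> * r p + (u - p) \<bullet> (v - p) \<le> \<tau> * r v"
    using prox_minimiser_variational(2)[OF D min] by simp
  then show "r p + ((u - p) \<bullet> (v - p)) / \<tau> \<le> r v"
    using assms(3) by (simp add: field_simps)
qed

text \<open>As a supremum of affine functions, the conjugate inherits convexity and lower
  semicontinuity. Properness needs a point where it is finite: if \<open>p\<close> is the proximal
  point of 0, then \<open>- p\<close> is a subgradient of \<open>g\<close> at \<open>p\<close>, so
  the supremum at \<open>- p\<close> is attained at \<open>p\<close>.\<close>

lemma proper_lsc_convex_conjugate:
  fixes g :: "'a::{real_inner,banach} \<Rightarrow> ereal"
  assumes "proper_lsc_convex g"
  shows "proper_lsc_convex (conjugate g)"
proof -
  obtain D r where D: "domain_repr g D r" using assms proper_lsc_convexE by blast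
  then obtain u0 where u0: "u0 \<in> D" by (auto simp: domain_repr_def)
  have gD: "g v = ereal (r v)" if "v \<in> D" for v using D that by (simp add: domain_repr_def)
  have low: "ereal (u \<bullet> v - r u) \<le> conjugate g v" if "u \<in> D" for u v
    unfolding conjugate_def by (rule SUP_upper2[of u]) (use gD that in auto)
  have up: "conjugate g v \<le> c" if "\<And>u. u \<in> D \<Longrightarrow> ereal (u \<bullet> v - r u) \<le> c" for v c
    unfolding conjugate_def
  proof (rule SUP_least)
    fix u show "ereal (u \<bullet> v) - g u \<le> c"
      using that[of u] D by (cases "u \<in> D") (auto simp: domain_repr_def)
  qed
  obtain p where "\<And>v. g p + ereal ((norm (0 - p))\<^sup>2 / 2) \<le> g v + ereal ((norm (0 - v))\<^sup>2 / 2)"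
    using prox_minimiser_exists[OF assms, of 0] by blast
  note p = prox_minimiser_variational[OF D this]
  have "conjugate g (0 - p) \<le> ereal ((0 - p) \<bullet> p - r p)"
  proof (rule up)
    fix u assume "u \<in> D"
    then show "ereal (u \<bullet> (0 - p) - r u) \<le> ereal ((0 - p) \<bullet> p - r p)"
      using p(2)[of u] by (simp add: inner_diff_right inner_commute)
  qed
  then have fin: "conjugate g (0 - p) \<noteq> \<infinity>" by auto
  have "conjugate g v \<noteq> -\<infinity>" for v using low[OF u0, of v] by auto
  then have "proper (conjugate g)" unfolding proper_def using fin by blast
  moreover have "ereal_convex (conjugate g)"
    unfolding ereal_convex_def
  proof (intro allI ballI)
    fix v w and t :: real assume t: "t \<in> {0..1}"
    show "conjugate g ((1 - t) *\<^sub>R v + t *\<^sub>R w) \<le> ereal (1 - t) * conjugate g v + ereal t * conjugate g w"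
    proof (rule up)
      fix u assume u: "u \<in> D"
      have "ereal (u \<bullet> ((1 - t) *\<^sub>R v + t *\<^sub>R w) - r u)
          = ereal (1 - t) * ereal (u \<bullet> v - r u) + ereal t * ereal (u \<bullet> w - r u)"
        by (simp add: inner_add_right algebra_simps)
      also have "\<dots> \<le> ereal (1 - t) * conjugate g v + ereal t * conjugate g w"
        using t low[OF u] by (intro add_mono ereal_mult_left_mono) auto
      finally show "ereal (u \<bullet> ((1 - t) *\<^sub>R v + t *\<^sub>R w) - r u)
          \<le> ereal (1 - t) * conjugate g v + ereal t * conjugate g w" .
    qed
  qed
  moreover have "lsc (conjugate g)"
    unfolding lsc_iff_eventually
  proof (intro allI impI)
    fix q c assume "c < conjugate g q"
    then obtain u where u: "u \<in> D" "c < ereal (u \<bullet> q - r u)"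
      using up[of q c] by (meson not_le)
    have "((\<lambda>v. ereal (u \<bullet> v - r u)) \<longlongrightarrow> ereal (u \<bullet> q - r u)) (nhds q)"
      by (intro tendsto_intros filterlim_ident)
    then have "\<forall>\<^sub>F v in nhds q. c < ereal (u \<bullet> v - r u)" using u(2) by (rule order_tendstoD)
    then show "\<forall>\<^sub>F v in nhds q. c < conjugate g v"
      by eventually_elim (use low[OF u(1)] in \<open>meson less_le_trans\<close>)
  qed
  ultimately show ?thesis by (simp add: proper_lsc_convex_def)
qed

section \<open>The adjoint\<close>

text \<open>The Riesz representative of \<open>l\<close> minimises \<open>\<parallel>v\<parallel>\<^sup>2 / 2 - l v\<close>. The library defines
  \<open>adjoint\<close> by a choice operator and proves that it is an adjoint only in Euclidean spaces.\<close>

lemma riesz_representation: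
  fixes l :: "'a::{real_inner,banach} \<Rightarrow> real"
  assumes "bounded_linear l"
  shows "\<exists>p. \<forall>v. l v = p \<bullet> v"
proof -
  interpret bounded_linear l by fact
  have D: "domain_repr (\<lambda>v. ereal (- l v)) UNIV (\<lambda>v. - l v)"
    by (auto simp: domain_repr_def convex_on_def add scaleR)
  have "lsc (\<lambda>v. ereal (- l v))"
    unfolding lsc_iff_eventually
  proof (intro allI impI)
    fix p c assume "c < ereal (- l p)"
    moreover have "((\<lambda>v. ereal (- l v)) \<longlongrightarrow> ereal (- l p)) (nhds p)"
      by (intro tendsto_intros tendsto filterlim_ident)
    ultimately show "\<forall>\<^sub>F v in nhds p. c < ereal (- l v)" by (rule order_tendstoD(1)[rotated])
  qed
  then have "proper_lsc_convex (\<lambda>v. ereal (- l v))"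
    using domain_repr_imp[OF D] by (simp add: proper_lsc_convex_def)
  then obtain p where p:
    "\<And>v. ereal (- l p) + ereal ((norm (0 - p))\<^sup>2 / 2) \<le> ereal (- l v) + ereal ((norm (0 - v))\<^sup>2 / 2)"
    using prox_minimiser_exists by blast
  have le: "l v \<le> p \<bullet> v" for v
    using prox_minimiser_variational(2)[OF D p, of "p + v"] by (simp add: add)
  have "l v = p \<bullet> v" for v
    using le[of v] le[of "- v"] by (simp add: neg)
  then show ?thesis by blast
qed

text \<open>Riesz representation of \<open>A x \<bullet> y\<close> as a functional of
  \<open>x\<close>, for each \<open>y\<close>, shows that the choice behind \<open>adjoint\<close>
  has an admissible value.\<close>

lemma adjoint_hilbert:
  fixes A :: "'a::{real_inner,banach} \<Rightarrow> 'b::real_inner"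
  assumes "bounded_linear A"
  shows "A x \<bullet> y = x \<bullet> adjoint A y"
proof -
  have "\<exists>p. \<forall>x. A x \<bullet> y = p \<bullet> x" for y
    by (intro riesz_representation bounded_linear_intros assms)
  then obtain A' where "\<And>x y. A x \<bullet> y = A' y \<bullet> x" by metis
  then have "\<exists>A'. \<forall>x y. A x \<bullet> y = x \<bullet> A' y" by (intro exI[of _ A']) (simp add: inner_commute)
  then have "\<forall>x y. A x \<bullet> y = x \<bullet> adjoint A y" unfolding adjoint_def by (rule someI_ex)
  then show ?thesis by blast
qed

lemma norm_adjoint_le:
  fixes A :: "'a::{real_inner,banach} \<Rightarrow> 'b::real_inner"
  assumes "bounded_linear A"
  shows "norm (adjoint A y) \<le> onorm A * norm y"
proof (cases "adjoint A y = 0")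
  case True
  then show ?thesis using onorm_pos_le[OF assms] by simp
next
  case False
  have "norm (adjoint A y) * norm (adjoint A y) = A (adjoint A y) \<bullet> y"
    by (simp add: adjoint_hilbert[OF assms] flip: power2_eq_square power2_norm_eq_inner)
  also have "\<dots> \<le> norm (A (adjoint A y)) * norm y" by (rule norm_cauchy_schwarz)
  also have "\<dots> \<le> (onorm A * norm (adjoint A y)) * norm y"
    by (intro mult_right_mono onorm[OF assms]) simp
  finally have "norm (adjoint A y) * norm (adjoint A y) \<le> norm (adjoint A y) * (onorm A * norm y)"
    by (simp add: mult_ac)
  then show ?thesis using False by simp
qed

section \<open>Lipschitz gradients\<close>

text \<open>Descent lemma. On the segment from \<open>u\<close> to \<open>v\<close>,
  \<open>\<phi>\<close> is the function minus the linear and quadratic terms of the bound; the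
  Lipschitz condition makes its derivative nonpositive.\<close>

lemma lipschitz_gradient_upper:
  fixes h :: "'a::real_inner \<Rightarrow> real"
  assumes grad: "\<And>u. GDERIV h u :> dh u" and lip: "C-lipschitz_on UNIV dh"
  shows "h v \<le> h u + dh u \<bullet> (v - u) + C / 2 * (norm (v - u))\<^sup>2"
proof -
  define w where "w = v - u"
  define \<phi> where "\<phi> t = h (u + t *\<^sub>R w) - t * (dh u \<bullet> w) - C / 2 * t\<^sup>2 * (norm w)\<^sup>2" for t
  have deriv: "(\<phi> has_real_derivative (dh (u + t *\<^sub>R w) - dh u) \<bullet> w - C * t * (norm w)\<^sup>2) (at t)" for t
  proof -
    have "((\<lambda>t. u + t *\<^sub>R w) has_derivative (\<lambda>s. s *\<^sub>R w)) (at t)"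
      by (auto intro!: derivative_eq_intros)
    from has_derivative_compose[OF this grad[unfolded gderiv_def]]
    have "((\<lambda>t. h (u + t *\<^sub>R w)) has_derivative (\<lambda>s. (s *\<^sub>R w) \<bullet> dh (u + t *\<^sub>R w))) (at t)" .
    then have 1: "((\<lambda>t. h (u + t *\<^sub>R w)) has_real_derivative dh (u + t *\<^sub>R w) \<bullet> w) (at t)"
      unfolding has_field_derivative_def
      by (rule has_derivative_eq_rhs) (simp add: fun_eq_iff inner_commute mult.commute)
    show ?thesis unfolding \<phi>_def
      by (rule derivative_eq_intros 1 refl)+ (simp add: inner_diff_left)
  qed
  have slope: "(dh (u + t *\<^sub>R w) - dh u) \<bullet> w \<le> C * t * (norm w)\<^sup>2" if "0 \<le> t" for t
  proof -
    have "(dh (u + t *\<^sub>R w) - dh u) \<bullet> w \<le> norm (dh (u + t *\<^sub>R w) - dh u) * norm w"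
      by (rule norm_cauchy_schwarz)
    also have "\<dots> \<le> (C * norm (t *\<^sub>R w)) * norm w"
      using lipschitz_onD[OF lip, of "u + t *\<^sub>R w" u]
      by (intro mult_right_mono) (auto simp: dist_norm)
    finally show ?thesis using that by (simp add: power2_eq_square mult_ac)
  qed
  have "\<phi> 1 \<le> \<phi> 0"
  proof (rule DERIV_nonpos_imp_nonincreasing[of 0 1 \<phi>])
    fix t :: real assume "0 \<le> t"
    from slope[OF this] have "(dh (u + t *\<^sub>R w) - dh u) \<bullet> w - C * t * (norm w)\<^sup>2 \<le> 0" by simp
    with deriv[of t] show "\<exists>y. (\<phi> has_real_derivative y) (at t) \<and> y \<le> 0" by blast
  qed simp
  then show ?thesis by (simp add: \<phi>_def w_def algebra_simps)
qed

text \<open>The descent lemma for \<open>- h\<close> gives the tangent bound up to a quadratic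
  error, and convexity removes that error.\<close>

lemma lipschitz_gradient_lower:
  fixes h :: "'a::real_inner \<Rightarrow> real"
  assumes grad: "\<And>u. GDERIV h u :> dh u" and lip: "C-lipschitz_on UNIV dh" and cv: "convex_on UNIV h"
  shows "h u + dh u \<bullet> (v - u) \<le> h v"
proof (rule convex_on_tangent_minorant[OF cv, where C = "C / 2"])
  fix v
  have "- h v \<le> - h u + - dh u \<bullet> (v - u) + C / 2 * (norm (v - u))\<^sup>2"
  proof (rule lipschitz_gradient_upper)
    show "GDERIV (\<lambda>v. - h v) u :> - dh u" for u using grad by (intro GDERIV_minus)
    show "C-lipschitz_on UNIV (\<lambda>u. - dh u)" using lip by simp
  qed
  then show "h u + dh u \<bullet> (v - u) \<le> h v + C / 2 * (norm (v - u))\<^sup>2" by simp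
qed auto

text \<open>For \<open>C > 0\<close>, the best choice of \<open>w\<close> turns this into the Baillon--Haddad inequality.\<close>

lemma lipschitz_gradient_cocoercive:
  fixes h :: "'a::real_inner \<Rightarrow> real"
  assumes grad: "\<And>u. GDERIV h u :> dh u" and lip: "C-lipschitz_on UNIV dh" and cv: "convex_on UNIV h"
  shows "(dh u - dh v) \<bullet> w \<le> (dh u - dh v) \<bullet> (u - v) + C / 4 * (norm w)\<^sup>2"
proof -
  \<comment> \<open>Below, the tangent at \<open>u\<close> and the quadratic upper model at
    \<open>v\<close> are compared at \<open>v + k\<close>. Adding the same inequality with
    \<open>u\<close> and \<open>v\<close> exchanged and \<open>- k\<close> for \<open>k\<close>
    cancels the function values; halving \<open>w\<close> then yields the constant
    \<open>C / 4\<close>.\<close>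
  define k where "k = (1 / 2) *\<^sub>R w"
  have *: "(dh u - dh v) \<bullet> k \<le> h v - h u - dh u \<bullet> (v - u) + C / 2 * (norm k)\<^sup>2" for u v k
    using order_trans[OF lipschitz_gradient_lower[OF assms, of u "v + k"]
        lipschitz_gradient_upper[OF grad lip, of "v + k" v]]
    by (simp add: inner_diff_left inner_diff_right inner_add_right)
  have "2 * ((dh u - dh v) \<bullet> k) \<le> (dh u - dh v) \<bullet> (u - v) + C * (norm k)\<^sup>2"
    using *[of u v k] *[of v u "- k"] by (simp add: inner_diff_left inner_diff_right)
  then show ?thesis by (simp add: k_def power2_eq_square)
qed

section \<open>The weighted norm\<close>

lemma normV_power2:
  assumes "\<tau> > 0" "\<sigma> > 0"
  shows "(normV \<tau> \<sigma> z)\<^sup>2 = (norm (fst z))\<^sup>2 / \<tau> + (norm (snd z))\<^sup>2 / \<sigma>"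
  using assms by (simp add: normV_def)

lemma normV_nonneg: "\<tau> > 0 \<Longrightarrow> \<sigma> > 0 \<Longrightarrow> 0 \<le> normV \<tau> \<sigma> z"
  by (simp add: normV_def)

lemma distV_bounds:
  assumes "\<tau> > 0" "\<sigma> > 0" "S \<noteq> {}"
  shows "0 \<le> distV \<tau> \<sigma> z S"
    and "(\<And>w. w \<in> S \<Longrightarrow> c \<le> normV \<tau> \<sigma> (z - w)) \<Longrightarrow> c \<le> distV \<tau> \<sigma> z S"
  using assms unfolding distV_def by (auto intro!: cINF_greatest normV_nonneg)

lemma power2_norm_diff_le:
  fixes u v w :: "'a::real_inner"
  shows "(norm (u - v))\<^sup>2 \<le> 2 * (norm (u - w))\<^sup>2 + 2 * (norm (v - w))\<^sup>2"
proof -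
  have "(norm (u - v))\<^sup>2 + (norm ((u - w) + (v - w)))\<^sup>2 = 2 * (norm (u - w))\<^sup>2 + 2 * (norm (v - w))\<^sup>2"
    by (simp add: power2_norm_eq_inner inner_diff_left inner_diff_right inner_add_left inner_add_right
        inner_commute algebra_simps)
  then show ?thesis by (smt (verit) zero_le_power2)
qed

text \<open>Lets the gap estimate at an arbitrary point be recentred at a saddle point. The factor 2
  on the last term is the origin of the condition \<open>K * \<beta> \<ge> 2\<close>.\<close>

lemma normV_diff_power2_le:
  fixes z w w' :: "'x::real_inner \<times> 'y::real_inner"
  assumes "\<tau> > 0" "\<sigma> > 0"
  shows "(normV \<tau> \<sigma> (z - w))\<^sup>2 \<le> 2 * (normV \<tau> \<sigma> (z - w'))\<^sup>2 + 2 * (normV \<tau> \<sigma> (w - w'))\<^sup>2"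
proof -
  have "(norm (fst z - fst w))\<^sup>2 / \<tau> \<le> (2 * (norm (fst z - fst w'))\<^sup>2 + 2 * (norm (fst w - fst w'))\<^sup>2) / \<tau>"
    "(norm (snd z - snd w))\<^sup>2 / \<sigma> \<le> (2 * (norm (snd z - snd w'))\<^sup>2 + 2 * (norm (snd w - snd w'))\<^sup>2) / \<sigma>"
    using assms by (auto intro!: divide_right_mono power2_norm_diff_le)
  then show ?thesis by (simp add: normV_power2[OF assms] add_divide_distrib)
qed

lemma inner_four_points:
  fixes a b c d :: "'a::real_inner"
  shows "2 * ((a - b) \<bullet> (c - d)) =
    (norm (a - d))\<^sup>2 - (norm (b - d))\<^sup>2 - (norm (a - c))\<^sup>2 + (norm (b - c))\<^sup>2"
  by (simp add: power2_norm_eq_inner inner_diff_left inner_diff_right inner_commute algebra_simps)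

lemma convex_on_mean:
  assumes "convex_on D h" "\<And>k. k < K \<Longrightarrow> v k \<in> D" "K > 0"
  shows "(1 / real K) *\<^sub>R (\<Sum>k<K. v k) \<in> D"
    and "h ((1 / real K) *\<^sub>R (\<Sum>k<K. v k)) \<le> (\<Sum>k<K. h (v k)) / real K"
proof -
  have K: "finite {..<K}" "{..<K} \<noteq> {}" "(\<Sum>k<K. 1 / real K) = 1" using assms(3) by auto
  show "(1 / real K) *\<^sub>R (\<Sum>k<K. v k) \<in> D"
    unfolding scaleR_sum_right using K assms(2)
    by (intro convex_sum convex_on_imp_convex[OF assms(1)]) auto
  show "h ((1 / real K) *\<^sub>R (\<Sum>k<K. v k)) \<le> (\<Sum>k<K. h (v k)) / real K"
    using convex_on_sum[OF K(1,2) assms(1) K(3), of v] assms(2)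
    by (simp add: scaleR_sum_right sum_divide_distrib)
qed

section \<open>One iteration\<close>

text \<open>\<open>gs\<close> and \<open>g2\<close> stand for the conjugates of the paper's \<open>g\<close> and \<open>g\<^sub>2\<close>.\<close>

locale pdhg =
  fixes f :: "'x::{real_inner,banach} \<Rightarrow> ereal" and Df :: "'x set" and fr f2 :: "'x \<Rightarrow> real"
    and df2 :: "'x \<Rightarrow> 'x"
    and gs :: "'y::{real_inner,banach} \<Rightarrow> ereal" and Dg :: "'y set" and gr g2 :: "'y \<Rightarrow> real"
    and dg2 :: "'y \<Rightarrow> 'y" and A :: "'x \<Rightarrow> 'y" and Lf Lg \<tau> \<sigma> \<gamma> \<alpha>f \<alpha>g :: real
  assumes f: "proper_lsc_convex f" "domain_repr f Df fr"
    and gs: "proper_lsc_convex gs" "domain_repr gs Dg gr"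
    and f2: "convex_on UNIV f2" "\<And>u. GDERIV f2 u :> df2 u" "Lf-lipschitz_on UNIV df2"
    and g2: "convex_on UNIV g2" "\<And>u. GDERIV g2 u :> dg2 u" "Lg-lipschitz_on UNIV dg2"
    and A: "bounded_linear A"
    and \<tau>: "\<tau> > 0" and \<sigma>: "\<sigma> > 0"
    and \<gamma>: "\<gamma> = \<sigma> * \<tau> * (onorm A)\<^sup>2"
    and \<alpha>f: "\<alpha>f = \<tau> * Lf / 2"
    and \<alpha>g: "\<alpha>g = \<sigma> * Lg / 2"
begin

abbreviation "bar \<equiv> pdhg_bar \<tau> \<sigma> f df2 gs dg2 A"
abbreviation "step \<equiv> pdhg_step \<tau> \<sigma> f df2 gs dg2 A"
abbreviation "N z \<equiv> (normV \<tau> \<sigma> z)\<^sup>2"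

definition lag :: "'x \<Rightarrow> 'y \<Rightarrow> real" where
  "lag x y = fr x + f2 x + A x \<bullet> y - gr y - g2 y"

text \<open>The order of the tests reproduces the convention
  \<open>\<infinity> - \<infinity> = \<infinity>\<close>: a primal point off its domain takes
  precedence.\<close>

definition Lag :: "'x \<Rightarrow> 'y \<Rightarrow> ereal" where
  "Lag x y = (if x \<notin> Df then \<infinity> else if y \<notin> Dg then -\<infinity> else ereal (lag x y))"

lemma convex_fr: "convex_on Df fr" and convex_gr: "convex_on Dg gr"
  using f gs by (auto simp: domain_repr_def)

text \<open>Optimality of the primal proximal step: \<open>(fst z - fst (bar z)) / \<tau> - df2 (fst
  z) - adjoint A (snd z)\<close> is a subgradient of \<open>f\<close> at the new point.\<close>

lemma bar_primal:
  shows "fst (bar z) \<in> Df"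
    and "x \<in> Df \<Longrightarrow> fr (fst (bar z)) + ((fst z - fst (bar z)) \<bullet> (x - fst (bar z))) / \<tau>
      - df2 (fst z) \<bullet> (x - fst (bar z)) - A (x - fst (bar z)) \<bullet> snd z \<le> fr x"
proof -
  let ?u = "fst z - \<tau> *\<^sub>R df2 (fst z) - \<tau> *\<^sub>R adjoint A (snd z)"
  have p: "fst (bar z) = prox (\<lambda>u. ereal \<tau> * f u) ?u" by (simp add: pdhg_bar_def Let_def)
  note v = prox_scaled_variational[OF f \<tau>, where u = ?u, folded p]
  show "fst (bar z) \<in> Df" by (rule v(1))
  assume "x \<in> Df"
  from v(2)[OF this] \<tau> show "fr (fst (bar z)) + ((fst z - fst (bar z)) \<bullet> (x - fst (bar z))) / \<tau>
      - df2 (fst z) \<bullet> (x - fst (bar z)) - A (x - fst (bar z)) \<bullet> snd z \<le> fr x"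
    by (simp add: adjoint_hilbert[OF A] inner_diff_left diff_divide_distrib
        inner_commute[of _ "adjoint A (snd z)"])
qed

text \<open>The dual counterpart, with \<open>A\<close> evaluated at the primal point just
  computed.\<close>

lemma bar_dual:
  shows "snd (bar z) \<in> Dg"
    and "y \<in> Dg \<Longrightarrow> gr (snd (bar z)) + ((snd z - snd (bar z)) \<bullet> (y - snd (bar z))) / \<sigma>
      - dg2 (snd z) \<bullet> (y - snd (bar z)) + A (fst (bar z)) \<bullet> (y - snd (bar z)) \<le> gr y"
proof -
  let ?u = "snd z - \<sigma> *\<^sub>R dg2 (snd z) + \<sigma> *\<^sub>R A (fst (bar z))"
  have p: "snd (bar z) = prox (\<lambda>u. ereal \<sigma> * gs u) ?u" by (simp add: pdhg_bar_def Let_def)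
  note v = prox_scaled_variational[OF gs \<sigma>, where u = ?u, folded p]
  show "snd (bar z) \<in> Dg" by (rule v(1))
  assume "y \<in> Dg"
  from v(2)[OF this] \<sigma> show "gr (snd (bar z)) + ((snd z - snd (bar z)) \<bullet> (y - snd (bar z))) / \<sigma>
      - dg2 (snd z) \<bullet> (y - snd (bar z)) + A (fst (bar z)) \<bullet> (y - snd (bar z)) \<le> gr y"
    by (simp add: inner_diff_left inner_add_left diff_divide_distrib add_divide_distrib)
qed

text \<open>The correction of the primal variable in \<open>step\<close> absorbs the bilinear term.\<close>

lemma step_distance:
  "2 * (((fst z - fst (bar z)) \<bullet> (fst (bar z) - fst w)) / \<tau>
      + ((snd z - snd (bar z)) \<bullet> (snd (bar z) - snd w)) / \<sigma>
      + A (fst (bar z) - fst w) \<bullet> (snd (bar z) - snd z))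
    \<le> N (z - w) - N (step z - w) - (norm (fst z - fst (bar z)))\<^sup>2 / \<tau>
      - (1 - \<gamma>) * ((norm (snd z - snd (bar z)))\<^sup>2 / \<sigma>)"
proof -
  obtain xb yb where b: "bar z = (xb, yb)" by fastforce
  define c where "c = adjoint A (yb - snd z)"
  have s: "step z = (xb - \<tau> *\<^sub>R c, yb)" by (simp add: pdhg_step_def b c_def)
  have "(norm c)\<^sup>2 \<le> (onorm A * norm (yb - snd z))\<^sup>2"
    unfolding c_def by (intro power_mono norm_adjoint_le A) simp
  then have "\<tau> * (norm c)\<^sup>2 \<le> \<tau> * (onorm A * norm (yb - snd z))\<^sup>2"
    using \<tau> by (intro mult_left_mono) auto
  also have "\<dots> = \<gamma> * ((norm (snd z - yb))\<^sup>2 / \<sigma>)"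
    using \<sigma> by (simp add: \<gamma> power_mult_distrib norm_minus_commute)
  \<comment> \<open>The square of the primal correction is charged to the dual increment, which
    leaves the coefficient \<open>1 - \<gamma>\<close> there.\<close>
  finally have c: "\<tau> * (norm c)\<^sup>2 \<le> \<gamma> * ((norm (snd z - yb))\<^sup>2 / \<sigma>)" .
  have "A (xb - fst w) \<bullet> (yb - snd z) = c \<bullet> (xb - fst w)"
    by (simp add: adjoint_hilbert[OF A] c_def inner_commute[of "adjoint A (yb - snd z)"])
  \<comment> \<open>Adding the bilinear term amounts to replacing \<open>xb\<close> by the corrected
    point \<open>xb - \<tau> *\<^sub>R c\<close> in the first factor.\<close>
  then have "2 * (((fst z - xb) \<bullet> (xb - fst w)) / \<tau> + A (xb - fst w) \<bullet> (yb - snd z))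
      = 2 * ((fst z - (xb - \<tau> *\<^sub>R c)) \<bullet> (xb - fst w)) / \<tau>"
    using \<tau> by (simp add: inner_diff_left inner_add_left field_simps)
  also have "\<dots> = ((norm (fst z - fst w))\<^sup>2 - (norm (xb - \<tau> *\<^sub>R c - fst w))\<^sup>2
      - (norm (fst z - xb))\<^sup>2 + (norm (- (\<tau> *\<^sub>R c)))\<^sup>2) / \<tau>"
    using inner_four_points[of "fst z" "xb - \<tau> *\<^sub>R c" xb "fst w"] by simp
  also have "\<dots> = (norm (fst z - fst w))\<^sup>2 / \<tau> - (norm (xb - \<tau> *\<^sub>R c - fst w))\<^sup>2 / \<tau>
      - (norm (fst z - xb))\<^sup>2 / \<tau> + \<tau> * (norm c)\<^sup>2"
    using \<tau> by (simp add: power_mult_distrib add_divide_distrib diff_divide_distrib power2_eq_square)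
  finally have x: "2 * (((fst z - xb) \<bullet> (xb - fst w)) / \<tau> + A (xb - fst w) \<bullet> (yb - snd z)) = \<dots>" .
  have "2 * ((snd z - yb) \<bullet> (yb - snd w)) / \<sigma>
      = ((norm (snd z - snd w))\<^sup>2 - (norm (yb - snd w))\<^sup>2 - (norm (snd z - yb))\<^sup>2) / \<sigma>"
    using inner_four_points[of "snd z" yb yb "snd w"] by simp
  then have y: "2 * (((snd z - yb) \<bullet> (yb - snd w)) / \<sigma>)
      = (norm (snd z - snd w))\<^sup>2 / \<sigma> - (norm (yb - snd w))\<^sup>2 / \<sigma> - (norm (snd z - yb))\<^sup>2 / \<sigma>"
    by (simp add: diff_divide_distrib)
  show ?thesis
    using x y c unfolding b s normV_power2[OF \<tau> \<sigma>] left_diff_distrib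
    by (simp only: fst_conv snd_conv fst_diff snd_diff distrib_left mult_1)
qed

text \<open>For each smooth term, the upper model at the new point and the tangent at the comparison
  point are both based at \<open>z\<close>. Together they cost \<open>\<alpha>f\<close> or
  \<open>\<alpha>g\<close> times the squared increment, and the factor 2 of the claim doubles
  this.\<close>

lemma gap_step:
  assumes x: "x \<in> Df" and y: "y \<in> Dg"
  shows "2 * (lag (fst (bar z)) y - lag x (snd (bar z)))
    \<le> N (z - (x, y)) - N (step z - (x, y))
      + (2 * \<alpha>f - 1) * ((norm (fst z - fst (bar z)))\<^sup>2 / \<tau>)
      + (2 * \<alpha>g - 1 + \<gamma>) * ((norm (snd z - snd (bar z)))\<^sup>2 / \<sigma>)"
proof -
  interpret A: bounded_linear A by (rule A)
  obtain xb yb where b: "bar z = (xb, yb)" by fastforce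
  define P Q where PQ: "P = (norm (fst z - xb))\<^sup>2 / \<tau>" "Q = (norm (snd z - yb))\<^sup>2 / \<sigma>"
  define s t where st: "s = ((fst z - xb) \<bullet> (xb - x)) / \<tau>" "t = ((snd z - yb) \<bullet> (yb - y)) / \<sigma>"
  have LP: "Lf / 2 * (norm (fst z - xb))\<^sup>2 = \<alpha>f * P"
    "Lg / 2 * (norm (snd z - yb))\<^sup>2 = \<alpha>g * Q"
    using \<tau> \<sigma> by (simp_all add: \<alpha>f \<alpha>g PQ)
  have "f2 xb - f2 x \<le> df2 (fst z) \<bullet> (xb - x) + \<alpha>f * P"
    using lipschitz_gradient_upper[OF f2(2,3), of xb "fst z"]
      lipschitz_gradient_lower[OF f2(2,3,1), of "fst z" x]
    unfolding LP[symmetric] by (simp add: inner_diff_right norm_minus_commute)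
  moreover have "g2 yb - g2 y \<le> dg2 (snd z) \<bullet> (yb - y) + \<alpha>g * Q"
    using lipschitz_gradient_upper[OF g2(2,3), of yb "snd z"]
      lipschitz_gradient_lower[OF g2(2,3,1), of "snd z" y]
    unfolding LP[symmetric] by (simp add: inner_diff_right norm_minus_commute)
  moreover have "fr xb - fr x \<le> s - df2 (fst z) \<bullet> (xb - x) - A (xb - x) \<bullet> snd z"
    using bar_primal(2)[OF x, of z] unfolding b
    by (simp add: st inner_diff_right inner_diff_left A.diff diff_divide_distrib)
  moreover have "gr yb - gr y \<le> t - dg2 (snd z) \<bullet> (yb - y) + A xb \<bullet> (yb - y)"
    using bar_dual(2)[OF y, of z] unfolding b
    by (simp add: st inner_diff_right inner_diff_left diff_divide_distrib)
  moreover note step_distance[of z "(x, y)", unfolded b fst_conv snd_conv, folded PQ st]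
  \<comment> \<open>All bilinear contributions collapse to the one term that
    \<open>step_distance\<close> accounts for.\<close>
  moreover have "- (A (xb - x) \<bullet> snd z) + A xb \<bullet> (yb - y) + A xb \<bullet> y - A x \<bullet> yb
      = A (xb - x) \<bullet> (yb - snd z)"
    by (simp add: inner_diff_right inner_diff_left A.diff)
  ultimately show ?thesis
    unfolding b lag_def fst_conv snd_conv PQ[symmetric] left_diff_distrib distrib_right mult.assoc
    by argo
qed

section \<open>Optimality conditions at a saddle point and the distance to it\<close>

definition saddle :: "'x \<Rightarrow> 'y \<Rightarrow> bool" where
  "saddle x y \<longleftrightarrow> x \<in> Df \<and> y \<in> Dg \<and> (\<forall>x'\<in>Df. lag x y \<le> lag x' y) \<and> (\<forall>y'\<in>Dg. lag x y' \<le> lag x y)"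

text \<open>First-order optimality: \<open>x\<close> minimises the Lagrangian in its first argument.
  Replacing \<open>f2\<close> by its upper model at \<open>x\<close> costs only a quadratic error,
  which \<open>convex_on_tangent_minorant\<close> removes.\<close>

lemma saddle_primal:
  assumes "saddle x y" "x' \<in> Df"
  shows "fr x - df2 x \<bullet> (x' - x) - A (x' - x) \<bullet> y \<le> fr x'"
proof -
  interpret A: bounded_linear A by (rule A)
  have "fr x + (- df2 x - adjoint A y) \<bullet> (x' - x) \<le> fr x'"
  proof (rule convex_on_tangent_minorant[OF convex_fr _ assms(2), where C = "Lf / 2"])
    show "x \<in> Df" using assms by (simp add: saddle_def)
    fix v assume "v \<in> Df"
    then have "fr x + f2 x + A x \<bullet> y \<le> fr v + f2 v + A v \<bullet> y"
      using assms(1) by (fastforce simp: saddle_def lag_def)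
    then show "fr x + (- df2 x - adjoint A y) \<bullet> (v - x) \<le> fr v + Lf / 2 * (norm (v - x))\<^sup>2"
      using lipschitz_gradient_upper[OF f2(2,3), of v x] adjoint_hilbert[OF A, of "v - x" y]
      by (simp add: inner_diff_left A.diff inner_commute[of _ "adjoint A y"] del: inner_diff_right)
  qed
  then show ?thesis
    using adjoint_hilbert[OF A, of "x' - x" y]
    by (simp add: inner_diff_left inner_commute[of _ "adjoint A y"])
qed

lemma saddle_dual:
  assumes "saddle x y" "y' \<in> Dg"
  shows "gr y - dg2 y \<bullet> (y' - y) + A x \<bullet> (y' - y) \<le> gr y'"
proof -
  have "gr y + (- dg2 y + A x) \<bullet> (y' - y) \<le> gr y'"
  proof (rule convex_on_tangent_minorant[OF convex_gr _ assms(2), where C = "Lg / 2"])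
    show "y \<in> Dg" using assms by (simp add: saddle_def)
    fix v assume "v \<in> Dg"
    then have "gr y + g2 y - A x \<bullet> y \<le> gr v + g2 v - A x \<bullet> v"
      using assms(1) by (fastforce simp: saddle_def lag_def)
    then show "gr y + (- dg2 y + A x) \<bullet> (v - y) \<le> gr v + Lg / 2 * (norm (v - y))\<^sup>2"
      using lipschitz_gradient_upper[OF g2(2,3), of v y]
      by (simp add: inner_diff_left inner_add_left inner_diff_right)
  qed
  then show ?thesis by (simp add: inner_add_left inner_diff_left)
qed

text \<open>Adding the subgradient inequalities at the new point and at the saddle point cancels the
  nonsmooth values. The remaining gradient differences are bounded by cocoercivity, at half the cost
  incurred in \<open>gap_step\<close>.\<close>

lemma saddle_step:
  assumes "saddle x y"
  shows "N (step z - (x, y)) + (1 - \<alpha>f) * ((norm (fst z - fst (bar z)))\<^sup>2 / \<tau>)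
      + (1 - \<alpha>g - \<gamma>) * ((norm (snd z - snd (bar z)))\<^sup>2 / \<sigma>) \<le> N (z - (x, y))"
proof -
  interpret A: bounded_linear A by (rule A)
  obtain xb yb where b: "bar z = (xb, yb)" by fastforce
  define P Q where PQ: "P = (norm (fst z - xb))\<^sup>2 / \<tau>" "Q = (norm (snd z - yb))\<^sup>2 / \<sigma>"
  define s t where st: "s = ((fst z - xb) \<bullet> (xb - x)) / \<tau>" "t = ((snd z - yb) \<bullet> (yb - y)) / \<sigma>"
  have D: "x \<in> Df" "y \<in> Dg" "xb \<in> Df" "yb \<in> Dg"
    using assms bar_primal(1)[of z] bar_dual(1)[of z] by (auto simp: saddle_def b)
  have LP: "Lf / 4 * (norm (fst z - xb))\<^sup>2 = \<alpha>f * P / 2"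
    "Lg / 4 * (norm (snd z - yb))\<^sup>2 = \<alpha>g * Q / 2"
    using \<tau> \<sigma> by (simp_all add: \<alpha>f \<alpha>g PQ)
  \<comment> \<open>With \<open>w = fst z - xb\<close>, the split
    \<open>x - xb = w - (fst z - x)\<close> lets the monotonicity term of cocoercivity
    cancel.\<close>
  have "- ((df2 (fst z) - df2 x) \<bullet> (xb - x)) \<le> \<alpha>f * P / 2"
    using lipschitz_gradient_cocoercive[OF f2(2,3,1), of "fst z" x "fst z - xb"]
    unfolding LP[symmetric] by (simp add: inner_diff_right)
  moreover have "- ((dg2 (snd z) - dg2 y) \<bullet> (yb - y)) \<le> \<alpha>g * Q / 2"
    using lipschitz_gradient_cocoercive[OF g2(2,3,1), of "snd z" y "snd z - yb"]
    unfolding LP[symmetric] by (simp add: inner_diff_right)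
  moreover have "fr xb - fr x \<le> s - df2 (fst z) \<bullet> (xb - x) - A (xb - x) \<bullet> snd z"
    using bar_primal(2)[OF D(1), of z] unfolding b
    by (simp add: st inner_diff_right inner_diff_left A.diff diff_divide_distrib)
  moreover have "gr yb - gr y \<le> t - dg2 (snd z) \<bullet> (yb - y) + A xb \<bullet> (yb - y)"
    using bar_dual(2)[OF D(2), of z] unfolding b
    by (simp add: st inner_diff_right inner_diff_left diff_divide_distrib)
  moreover note saddle_primal[OF assms D(3)] saddle_dual[OF assms D(4)]
  moreover note step_distance[of z "(x, y)", unfolded b fst_conv snd_conv, folded PQ st]
  moreover have "- (A (xb - x) \<bullet> snd z) + A xb \<bullet> (yb - y) + A (xb - x) \<bullet> y - A x \<bullet> (yb - y)
      = A (xb - x) \<bullet> (yb - snd z)"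
    by (simp add: inner_diff_right inner_diff_left A.diff)
  moreover have "(df2 (fst z) - df2 x) \<bullet> (xb - x) = df2 (fst z) \<bullet> (xb - x) - df2 x \<bullet> (xb - x)"
    "(dg2 (snd z) - dg2 y) \<bullet> (yb - y) = dg2 (snd z) \<bullet> (yb - y) - dg2 y \<bullet> (yb - y)"
    by (simp_all only: inner_diff_left)
  ultimately show ?thesis
    unfolding b lag_def fst_conv snd_conv PQ[symmetric] left_diff_distrib distrib_right mult.assoc
    by argo
qed

end

section \<open>Averaging and restarting\<close>

context pdhg
begin

text \<open>The estimate of \<open>saddle_step\<close>, multiplied by \<open>a\<close>, pays for the terms of \<open>gap_step\<close> that may
  have the wrong sign.\<close>

lemma gap_step_telescoping:
  assumes "saddle xs ys" "x \<in> Df" "y \<in> Dg" "0 \<le> a"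
    and a: "2 * \<alpha>f - 1 \<le> a * (1 - \<alpha>f)" "2 * \<alpha>g - 1 + \<gamma> \<le> a * (1 - \<alpha>g - \<gamma>)"
  shows "2 * (lag (fst (bar z)) y - lag x (snd (bar z)))
    \<le> (N (z - (x, y)) + a * N (z - (xs, ys)))
      - (N (step z - (x, y)) + a * N (step z - (xs, ys)))"
proof -
  define P Q where PQ: "P = (norm (fst z - fst (bar z)))\<^sup>2 / \<tau>"
    "Q = (norm (snd z - snd (bar z)))\<^sup>2 / \<sigma>"
  have "0 \<le> P" "0 \<le> Q" using \<tau> \<sigma> by (auto simp: PQ)
  then have "(2 * \<alpha>f - 1) * P \<le> a * (1 - \<alpha>f) * P" "(2 * \<alpha>g - 1 + \<gamma>) * Q \<le> a * (1 - \<alpha>g - \<gamma>) * Q"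
    using a by (auto intro: mult_right_mono)
  moreover have "a * (N (step z - (xs, ys)) + (1 - \<alpha>f) * P + (1 - \<alpha>g - \<gamma>) * Q) \<le> a * N (z - (xs, ys))"
    using mult_left_mono[OF saddle_step[OF assms(1), of z] assms(4)] by (simp only: PQ)
  ultimately show ?thesis
    using gap_step[OF assms(2,3), of z, folded PQ] unfolding distrib_left mult.assoc by argo
qed

text \<open>The one-step bounds telescope, and the final potential is dropped because it is
  nonnegative. Jensen's inequality passes to the average, the bilinear terms being preserved exactly
  by linearity.\<close>

lemma apdhg_gap:
  fixes z :: "'x \<times> 'y"
  assumes "K > 0"
  defines "zt \<equiv> apdhg \<tau> \<sigma> f df2 gs dg2 A K z"
  shows "fst zt \<in> Df" "snd zt \<in> Dg"
    and "\<lbrakk>saddle xs ys; x \<in> Df; y \<in> Dg; 0 \<le> a; 2 * \<alpha>f - 1 \<le> a * (1 - \<alpha>f);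
        2 * \<alpha>g - 1 + \<gamma> \<le> a * (1 - \<alpha>g - \<gamma>)\<rbrakk>
      \<Longrightarrow> 2 * real K * (lag (fst zt) y - lag x (snd zt)) \<le> N (z - (x, y)) + a * N (z - (xs, ys))"
proof -
  interpret A: bounded_linear A by (rule A)
  define Z where "Z k = (step ^^ k) z" for k
  define X Y where XY: "X k = fst (bar (Z k))" "Y k = snd (bar (Z k))" for k
  have zt: "fst zt = (1 / real K) *\<^sub>R (\<Sum>k<K. X k)" "snd zt = (1 / real K) *\<^sub>R (\<Sum>k<K. Y k)"
    by (simp_all add: zt_def apdhg_def XY Z_def fst_sum snd_sum)
  have X: "X k \<in> Df" and Y: "Y k \<in> Dg" for k
    using bar_primal(1) bar_dual(1) by (auto simp: XY)
  show zD: "fst zt \<in> Df" "snd zt \<in> Dg"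
    unfolding zt using convex_on_mean(1)[OF convex_fr X assms(1)] convex_on_mean(1)[OF convex_gr Y assms(1)]
    by auto
  assume sad: "saddle xs ys" and x: "x \<in> Df" and y: "y \<in> Dg"
    and a: "0 \<le> a" "2 * \<alpha>f - 1 \<le> a * (1 - \<alpha>f)" "2 * \<alpha>g - 1 + \<gamma> \<le> a * (1 - \<alpha>g - \<gamma>)"
  have "real K * fr (fst zt) \<le> (\<Sum>k<K. fr (X k))" "real K * f2 (fst zt) \<le> (\<Sum>k<K. f2 (X k))"
    "real K * gr (snd zt) \<le> (\<Sum>k<K. gr (Y k))" "real K * g2 (snd zt) \<le> (\<Sum>k<K. g2 (Y k))"
    unfolding zt using assms(1) X Y
      convex_on_mean(2)[OF convex_fr, where v = X and K = K] convex_on_mean(2)[OF f2(1), where v = X and K = K]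
      convex_on_mean(2)[OF convex_gr, where v = Y and K = K] convex_on_mean(2)[OF g2(1), where v = Y and K = K]
    by (simp_all add: pos_le_divide_eq mult.commute)
  moreover have "real K * (A (fst zt) \<bullet> y) = (\<Sum>k<K. A (X k) \<bullet> y)"
    "real K * (A x \<bullet> snd zt) = (\<Sum>k<K. A x \<bullet> Y k)"
    unfolding zt using assms(1) by (simp_all add: A.scaleR A.sum inner_sum_left inner_sum_right)
  moreover have "(\<Sum>k<K. lag (X k) y - lag x (Y k)) = (\<Sum>k<K. fr (X k)) + (\<Sum>k<K. f2 (X k))
      + (\<Sum>k<K. A (X k) \<bullet> y) - (\<Sum>k<K. A x \<bullet> Y k) + (\<Sum>k<K. gr (Y k)) + (\<Sum>k<K. g2 (Y k))
      - real K * (gr y + g2 y + fr x + f2 x)"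
    by (simp add: lag_def sum.distrib sum_subtractf algebra_simps)
  moreover have "real K * (lag (fst zt) y - lag x (snd zt)) = real K * fr (fst zt) + real K * f2 (fst zt)
      + real K * (A (fst zt) \<bullet> y) - real K * (A x \<bullet> snd zt) + real K * gr (snd zt) + real K * g2 (snd zt)
      - real K * (gr y + g2 y + fr x + f2 x)"
    by (simp add: lag_def algebra_simps)
  ultimately have jensen: "real K * (lag (fst zt) y - lag x (snd zt)) \<le> (\<Sum>k<K. lag (X k) y - lag x (Y k))"
    by linarith
  define \<Phi> where "\<Phi> k = N (Z k - (x, y)) + a * N (Z k - (xs, ys))" for k
  have "2 * (lag (X k) y - lag x (Y k)) \<le> \<Phi> k - \<Phi> (Suc k)" for k
    using gap_step_telescoping[OF sad x y a, of "Z k"] by (simp add: XY \<Phi>_def Z_def)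
  then have "(\<Sum>k<K. 2 * (lag (X k) y - lag x (Y k))) \<le> (\<Sum>k<K. \<Phi> k - \<Phi> (Suc k))"
    by (intro sum_mono)
  also have "\<dots> = \<Phi> 0 - \<Phi> K" by (rule sum_lessThan_telescope')
  also have "\<dots> \<le> \<Phi> 0"
    using mult_nonneg_nonneg[OF a(1) zero_le_power2, of "normV \<tau> \<sigma> (Z K - (xs, ys))"]
      zero_le_power2[of "normV \<tau> \<sigma> (Z K - (x, y))"]
    unfolding \<Phi>_def by linarith
  finally have "2 * (\<Sum>k<K. lag (X k) y - lag x (Y k)) \<le> \<Phi> 0" by (simp only: sum_distrib_left)
  with jensen show "2 * real K * (lag (fst zt) y - lag x (snd zt)) \<le> N (z - (x, y)) + a * N (z - (xs, ys))"
    by (simp add: \<Phi>_def Z_def)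
qed

text \<open>Recentring \<open>N (z - z')\<close> at the saddle point leaves twice the squared
  distance from \<open>z'\<close> to it, which the smoothing term absorbs because
  \<open>K * \<beta> \<ge> 2\<close>.\<close>

lemma smoothed_gap_apdhg:
  assumes "saddle xs ys" "0 \<le> a"
    and "2 * \<alpha>f - 1 \<le> a * (1 - \<alpha>f)" "2 * \<alpha>g - 1 + \<gamma> \<le> a * (1 - \<alpha>g - \<gamma>)"
    and K: "K > 0" "real K * \<beta> \<ge> 2"
  shows "smoothed_gap \<tau> \<sigma> Lag \<beta> (apdhg \<tau> \<sigma> f df2 gs dg2 A K z) (xs, ys)
    \<le> ereal ((2 + a) / (2 * real K) * N (z - (xs, ys)))"
  unfolding smoothed_gap_def
proof (rule SUP_least)
  define zt where "zt = apdhg \<tau> \<sigma> f df2 gs dg2 A K z"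
  note gap = apdhg_gap[OF K(1), where z = z, folded zt_def]
  fix z' :: "'x \<times> 'y"
  obtain x y where z': "z' = (x, y)" by fastforce
  show "Lag (fst (apdhg \<tau> \<sigma> f df2 gs dg2 A K z)) (snd z') - Lag (fst z') (snd (apdhg \<tau> \<sigma> f df2 gs dg2 A K z))
      - ereal (\<beta> / 2 * N (z' - (xs, ys))) \<le> ereal ((2 + a) / (2 * real K) * N (z - (xs, ys)))"
    unfolding zt_def[symmetric]
  proof (cases "x \<in> Df \<and> y \<in> Dg")
    \<comment> \<open>The averaged point lies in both domains, so the whole expression is
      \<open>-\<infinity>\<close> here.\<close>
    case False
    then show "Lag (fst zt) (snd z') - Lag (fst z') (snd zt)
        - ereal (\<beta> / 2 * N (z' - (xs, ys))) \<le> ereal ((2 + a) / (2 * real K) * N (z - (xs, ys)))"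
      using gap(1,2) by (auto simp: Lag_def z')
  next
    case True
    define n where "n = N ((x, y) - (xs, ys))"
    have "2 * real K * (lag (fst zt) y - lag x (snd zt)) \<le> N (z - (x, y)) + a * N (z - (xs, ys))"
      using gap(3) assms(1-4) True by blast
    also have "\<dots> \<le> (2 + a) * N (z - (xs, ys)) + 2 * n"
      using normV_diff_power2_le[OF \<tau> \<sigma>, of z "(x, y)" "(xs, ys)"] by (simp add: distrib_right n_def)
    also have "\<dots> \<le> (2 + a) * N (z - (xs, ys)) + real K * \<beta> * n"
      using mult_right_mono[OF K(2), of n] by (simp add: n_def)
    finally have "lag (fst zt) y - lag x (snd zt) - \<beta> / 2 * n \<le> (2 + a) / (2 * real K) * N (z - (xs, ys))"
      using K(1) by (simp add: field_simps)
    then show "Lag (fst zt) (snd z') - Lag (fst z') (snd zt)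
        - ereal (\<beta> / 2 * N (z' - (xs, ys))) \<le> ereal ((2 + a) / (2 * real K) * N (z - (xs, ys)))"
      using gap(1,2) True by (simp add: Lag_def z' n_def)
  qed
qed

text \<open>Comparison with one point of each nonempty domain rules out infinite values at a saddle
  point.\<close>

lemma saddle_points_Lag:
  assumes "(x, y) \<in> saddle_points Lag"
  shows "saddle x y"
proof -
  have le: "Lag x y' \<le> Lag x y" "Lag x y \<le> Lag x' y" for x' y'
    using assms by (auto simp: saddle_points_def)
  obtain x0 y0 where 0: "x0 \<in> Df" "y0 \<in> Dg" using f gs by (auto simp: domain_repr_def)
  have x: "x \<in> Df" using le(2)[of x0] 0 by (auto simp: Lag_def split: if_splits)
  have y: "y \<in> Dg" using le(1)[of y0] 0 x by (auto simp: Lag_def split: if_splits)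
  show ?thesis
    unfolding saddle_def
  proof (intro conjI ballI x y)
    show "lag x y \<le> lag x' y" if "x' \<in> Df" for x' using le(2)[of x'] that x y by (simp add: Lag_def)
    show "lag x y' \<le> lag x y" if "y' \<in> Dg" for y' using le(1)[of y'] that x y by (simp add: Lag_def)
  qed
qed

lemma apdhg_contraction:
  fixes K :: nat and z :: "'x \<times> 'y"
  defines "zt \<equiv> apdhg \<tau> \<sigma> f df2 gs dg2 A K z" and "S \<equiv> saddle_points Lag"
  assumes "S \<noteq> {}" "0 \<le> a"
    and "2 * \<alpha>f - 1 \<le> a * (1 - \<alpha>f)" "2 * \<alpha>g - 1 + \<gamma> \<le> a * (1 - \<alpha>g - \<gamma>)"
    and K: "real K * \<beta> \<ge> 2" "real K * \<eta> \<ge> 2 * (2 + a)"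
    and qeb: "\<And>w. w \<in> S \<Longrightarrow> ereal (\<eta> / 2 * (distV \<tau> \<sigma> zt S)\<^sup>2) \<le> smoothed_gap \<tau> \<sigma> Lag \<beta> zt w"
  shows "(distV \<tau> \<sigma> zt S)\<^sup>2 \<le> (distV \<tau> \<sigma> z S)\<^sup>2 / 2"
proof -
  have K0: "K > 0" using K(1) by (cases K) auto
  define d where "d = distV \<tau> \<sigma> zt S"
  have d: "0 \<le> d" unfolding d_def by (rule distV_bounds(1)[OF \<tau> \<sigma> assms(3)])
  \<comment> \<open>Stated for the unsquared norm and every \<open>w\<close>, so that the infimum
    defining \<open>distV\<close> can be taken without choosing a nearest saddle point.\<close>
  have "sqrt 2 * d \<le> normV \<tau> \<sigma> (z - w)" if w: "w \<in> S" for w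
  proof -
    obtain xs ys where ws: "w = (xs, ys)" by fastforce
    have "saddle xs ys" using w saddle_points_Lag by (auto simp: S_def ws)
    then have "smoothed_gap \<tau> \<sigma> Lag \<beta> zt w \<le> ereal ((2 + a) / (2 * real K) * N (z - w))"
      unfolding zt_def ws using smoothed_gap_apdhg assms(4-6) K0 K(1) by blast
    then have "ereal (\<eta> / 2 * d\<^sup>2) \<le> ereal ((2 + a) / (2 * real K) * N (z - w))"
      using qeb[OF w] unfolding d_def by (rule order_trans[rotated])
    then have "real K * \<eta> * d\<^sup>2 \<le> (2 + a) * N (z - w)" using K0 by (simp add: field_simps)
    then have "2 * (2 + a) * d\<^sup>2 \<le> (2 + a) * N (z - w)"
      using mult_right_mono[OF K(2), of "d\<^sup>2"] by simp
    then have "(2 + a) * (2 * d\<^sup>2) \<le> (2 + a) * N (z - w)" by (simp only: mult_ac)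
    then have "(sqrt 2 * d)\<^sup>2 \<le> N (z - w)" using assms(4) by (simp add: power_mult_distrib)
    then show ?thesis by (rule power2_le_imp_le) (rule normV_nonneg[OF \<tau> \<sigma>])
  qed
  then have "sqrt 2 * d \<le> distV \<tau> \<sigma> z S" by (rule distV_bounds(2)[OF \<tau> \<sigma> assms(3)])
  then have "(sqrt 2 * d)\<^sup>2 \<le> (distV \<tau> \<sigma> z S)\<^sup>2" using d by (intro power_mono) auto
  then show ?thesis by (simp add: d_def power_mult_distrib)
qed

end

section \<open>Rounding of the restart period and the linear rate\<close>

lemma divide_le_imp_le_mult:
  fixes p q c :: real
  assumes "q > 0" "p / q \<le> c"
  shows "p \<le> c * q"
  using assms by (simp add: pos_divide_le_eq)

text \<open>The maximum \<open>M\<close> of the reciprocals equals \<open>1 / m\<close>, and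
  \<open>M \<le> n < M + 1\<close>. This quantifies the approximate equality of the rates.\<close>

lemma inverse_ceiling_bounds:
  fixes p q :: real
  assumes "p > 0" "q > 0"
  defines "n \<equiv> \<lceil>max (1 / p) (1 / q)\<rceil>" and "m \<equiv> min p q"
  shows "1 / real_of_int n \<le> m" "m / (1 + m) < 1 / real_of_int n"
proof -
  define M where "M = max (1 / p) (1 / q)"
  have m: "m > 0" "M = 1 / m" using assms(1,2) by (auto simp: M_def m_def max_def min_def field_simps)
  have n: "M \<le> real_of_int n" "real_of_int n < M + 1" unfolding n_def M_def by linarith+
  have "M > 0" using m by simp
  then have M: "M > 0" "real_of_int n > 0" using n(1) by linarith+
  show "1 / real_of_int n \<le> m" using n(1) M m by (simp add: field_simps)
  have "m / (1 + m) = 1 / (M + 1)" using m(1) unfolding m(2) by (simp add: field_simps)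
  also have "\<dots> < 1 / real_of_int n" using n(2) M by (simp add: field_simps)
  finally show "m / (1 + m) < 1 / real_of_int n" .
qed

text \<open>The region enters through the requirement that the restart points with
  \<open>s \<ge> 1\<close> lie in \<open>R\<close>. The approximate equality becomes a two-sided
  bound on the rate, with exponents \<open>m\<close> and \<open>m / (1 + m)\<close>.\<close>

theorem proposition14:
  fixes f f2 :: "'x::{real_inner,banach} \<Rightarrow> ereal"
    and g g2 :: "'y::{real_inner,banach} \<Rightarrow> ereal"
    and A :: "'x \<Rightarrow> 'y"
    and df2 :: "'x \<Rightarrow> 'x" and dgs2 :: "'y \<Rightarrow> 'y"
    and Lf Lgs \<tau> \<sigma> \<gamma> \<alpha>f \<alpha>g a2 a2p \<beta> \<eta> :: real
    and L :: "'x \<Rightarrow> 'y \<Rightarrow> ereal"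
    and Zs R :: "('x \<times> 'y) set"
    and z0 :: "'x \<times> 'y"
    and zR :: "nat \<Rightarrow> nat \<Rightarrow> 'x \<times> 'y"
  assumes f: "proper_lsc_convex f"
    and f2: "proper_lsc_convex f2"
    and g: "proper_lsc_convex g"
    and g2: "proper_lsc_convex g2"
    and A: "bounded_linear A"
    and df2: "has_lipschitz_gradient f2 df2 Lf"
    and dgs2: "has_lipschitz_gradient (conjugate g2) dgs2 Lgs"
    and L: "L = lagrangian f f2 g g2 A"
    and Zs: "Zs = saddle_points L"
    and saddle_nonempty: "Zs \<noteq> {}"
    and steps: "\<tau> > 0" "\<sigma> > 0"
    and \<gamma>: "\<gamma> = \<sigma> * \<tau> * (onorm A)\<^sup>2"
    and \<alpha>f: "\<alpha>f = \<tau> * Lf / 2"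
    and \<alpha>g: "\<alpha>g = \<sigma> * Lgs / 2"
    and step_sizes: "\<gamma> < 1" "\<alpha>f < 1" "\<alpha>g < 1"
    and a2_denominator_pos: "1 - \<alpha>g - \<gamma> > 0"
    and a2: "a2 = max ((2 * \<alpha>f - 1) / (1 - \<alpha>f)) ((2 * \<alpha>g - 1 + \<gamma>) / (1 - \<alpha>g - \<gamma>))"
    and a2p: "a2p = max 0 a2"
    and zR: "\<And>K s. zR K s = rapdhg \<tau> \<sigma> f df2 (conjugate g) dgs2 A K z0 s"
    and \<beta>: "\<beta> > 0"
    and \<eta>: "\<eta> > 0"
    and qeb: "\<And>zs. zs \<in> Zs \<Longrightarrow>
      quadratic_error_bound \<tau> \<sigma> (\<lambda>z. smoothed_gap \<tau> \<sigma> L \<beta> z zs) Zs \<eta> R"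
  shows
    "(\<forall>K::nat. real K * \<beta> \<ge> 2 \<longrightarrow> real K * \<eta> \<ge> 2 * (2 + a2p) \<longrightarrow> (\<forall>s\<ge>1. zR K s \<in> R) \<longrightarrow>
        converges_linearly \<tau> \<sigma> Zs K (zR K) (2 powr (- 1 / real K))) \<and>
     (let K = nat \<lceil>max (2 / \<beta>) (2 * (2 + a2p) / \<eta>)\<rceil>;
          r = exp (- (1 / real_of_int \<lceil>max (2 / \<beta>) (2 * (2 + a2p) / \<eta>)\<rceil>) * ln 2);
          m = min (\<beta> / 2) (\<eta> / (2 * (2 + a2p)))
      in ((\<forall>s\<ge>1. zR K s \<in> R) \<longrightarrow> converges_linearly \<tau> \<sigma> Zs K (zR K) r) \<and>
         exp (- m * ln 2) \<le> r \<and> r < exp (- (m / (1 + m)) * ln 2))"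
proof -
  obtain Df fr where Df: "domain_repr f Df fr" using f proper_lsc_convexE by blast
  have gs: "proper_lsc_convex (conjugate g)" using g by (rule proper_lsc_convex_conjugate)
  then obtain Dg gr where Dg: "domain_repr (conjugate g) Dg gr" using proper_lsc_convexE by blast
  have real_conv: "convex_on UNIV (\<lambda>v. real_of_ereal (h v))" and real_eq: "h v = ereal (real_of_ereal (h v))"
    if "proper_lsc_convex h" "has_lipschitz_gradient h dh C"
    for h :: "'c::real_inner \<Rightarrow> ereal" and dh C v
  proof -
    have fin: "\<bar>h v\<bar> \<noteq> \<infinity>" for v using that(2) by (simp add: has_lipschitz_gradient_def)
    then have "h v \<noteq> \<infinity>" for v by (metis abs_ereal.simps(3))
    then have "{v. h v \<noteq> \<infinity>} = UNIV" by simp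
    moreover have "domain_repr h {v. h v \<noteq> \<infinity>} (\<lambda>v. real_of_ereal (h v))"
      using that(1) proper_convex_repr by (auto simp: proper_lsc_convex_def)
    ultimately show "convex_on UNIV (\<lambda>v. real_of_ereal (h v))" "h v = ereal (real_of_ereal (h v))"
      using fin by (auto simp: domain_repr_def ereal_real)
  qed
  note gs2 = proper_lsc_convex_conjugate[OF g2]
  interpret P: pdhg f Df fr "\<lambda>v. real_of_ereal (f2 v)" df2 "conjugate g" Dg gr
    "\<lambda>v. real_of_ereal (conjugate g2 v)" dgs2 A Lf Lgs \<tau> \<sigma> \<gamma> \<alpha>f \<alpha>g
    using df2 dgs2 by (intro pdhg.intro)
      (use f Df gs Dg A steps \<gamma> \<alpha>f \<alpha>g real_conv[OF f2 df2] real_conv[OF gs2 dgs2]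
        in \<open>auto simp: has_lipschitz_gradient_def\<close>)
  \<comment> \<open>Since \<open>f2\<close> and \<open>conjugate g2\<close> are finite everywhere,
    only \<open>f\<close> and \<open>conjugate g\<close> decide where the Lagrangian is
    infinite.\<close>
  have "L x y = P.Lag x y" for x y
    unfolding L lagrangian_def P.Lag_def P.lag_def
    by (subst real_eq[OF f2 df2], subst real_eq[OF gs2 dgs2])
      (use Df Dg in \<open>simp add: domain_repr_def\<close>)
  then have LLag: "L = P.Lag" by blast
  \<comment> \<open>Both denominators in \<open>a2\<close> being positive, \<open>a2p\<close> is the
    least nonnegative multiplier that satisfies the two compensation conditions.\<close>
  have a: "0 \<le> a2p" "2 * \<alpha>f - 1 \<le> a2p * (1 - \<alpha>f)" "2 * \<alpha>g - 1 + \<gamma> \<le> a2p * (1 - \<alpha>g - \<gamma>)"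
    using step_sizes(2) a2_denominator_pos by (auto simp: a2p a2 intro!: divide_le_imp_le_mult)
  \<comment> \<open>Only \<open>r ^ K = 1 / 2\<close> matters, which covers both ways of writing the
    rate.\<close>
  have conv: "converges_linearly \<tau> \<sigma> Zs K (zR K) r"
    if K: "real K * \<beta> \<ge> 2" "real K * \<eta> \<ge> 2 * (2 + a2p)" and R: "\<forall>s\<ge>1. zR K s \<in> R" and r: "r ^ K = 1 / 2"
    for K r
    unfolding converges_linearly_def
  proof
    fix s
    show "(distV \<tau> \<sigma> (zR K s) Zs)\<^sup>2 \<le> r ^ (s * K) * (distV \<tau> \<sigma> (zR K 0) Zs)\<^sup>2"
    proof (induction s)
      case (Suc s)
      have z: "zR K (Suc s) = apdhg \<tau> \<sigma> f df2 (conjugate g) dgs2 A K (zR K s)"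
        by (simp add: zR rapdhg_def)
      have "(distV \<tau> \<sigma> (zR K (Suc s)) Zs)\<^sup>2 \<le> (distV \<tau> \<sigma> (zR K s) Zs)\<^sup>2 / 2"
        unfolding z Zs LLag
      proof (rule P.apdhg_contraction[OF _ a K])
        show "saddle_points P.Lag \<noteq> {}" using saddle_nonempty by (simp add: Zs LLag)
        fix w assume "w \<in> saddle_points P.Lag"
        then show "ereal (\<eta> / 2 * (distV \<tau> \<sigma> (apdhg \<tau> \<sigma> f df2 (conjugate g) dgs2 A K (zR K s)) (saddle_points P.Lag))\<^sup>2)
            \<le> smoothed_gap \<tau> \<sigma> P.Lag \<beta> (apdhg \<tau> \<sigma> f df2 (conjugate g) dgs2 A K (zR K s)) w"
          \<comment> \<open>The error bound is applied at the output of a cycle, so membership of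
            \<open>z0\<close> in \<open>R\<close> is never invoked.\<close>
          using qeb[of w] R[rule_format, of "Suc s"] by (simp add: quadratic_error_bound_def Zs LLag z)
      qed
      also have "\<dots> \<le> r ^ (s * K) * (distV \<tau> \<sigma> (zR K 0) Zs)\<^sup>2 / 2" using Suc by simp
      also have "\<dots> = r ^ (Suc s * K) * (distV \<tau> \<sigma> (zR K 0) Zs)\<^sup>2" by (simp add: power_add r)
      finally show ?case .
    qed simp
  qed
  have half: "exp (- (1 / real K) * ln 2) ^ K = 1 / 2" if "K > 0" for K :: nat
    using that exp_of_nat_mult[of K "- (1 / real K) * ln 2"] by (simp add: exp_minus)
  define n where "n = \<lceil>max (2 / \<beta>) (2 * (2 + a2p) / \<eta>)\<rceil>"
  define m where "m = min (\<beta> / 2) (\<eta> / (2 * (2 + a2p)))"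
  have pos: "\<beta> / 2 > 0" "\<eta> / (2 * (2 + a2p)) > 0" using \<beta> \<eta> a(1) by auto
  have bounds: "1 / real_of_int n \<le> m" "m / (1 + m) < 1 / real_of_int n"
    using inverse_ceiling_bounds[OF pos] unfolding n_def m_def by (simp_all only: divide_divide_eq_right mult_1)
  have nM: "2 / \<beta> \<le> real_of_int n" "2 * (2 + a2p) / \<eta> \<le> real_of_int n"
    unfolding n_def by (rule order_trans[OF _ le_of_int_ceiling], simp)+
  have "0 < 2 / \<beta>" using \<beta> by simp
  then have "0 < real_of_int n" using nM(1) by linarith
  then have n0: "n > 0" "real (nat n) = real_of_int n" by auto
  have nK: "real (nat n) * \<beta> \<ge> 2" "real (nat n) * \<eta> \<ge> 2 * (2 + a2p)"
    unfolding n0 using nM \<beta> \<eta> by (auto intro: divide_le_imp_le_mult)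
  show ?thesis
    unfolding Let_def n_def[symmetric] m_def[symmetric]
  proof (intro conjI allI impI)
    fix K :: nat
    assume K: "2 \<le> real K * \<beta>" "2 * (2 + a2p) \<le> real K * \<eta>" "\<forall>s\<ge>1. zR K s \<in> R"
    then have "K > 0" by (cases K) auto
    then have "(2 powr (- 1 / real K)) ^ K = (1 / 2 :: real)" using half by (simp add: powr_def)
    then show "converges_linearly \<tau> \<sigma> Zs K (zR K) (2 powr (- 1 / real K))" by (rule conv[OF K])
  next
    assume "\<forall>s\<ge>1. zR (nat n) s \<in> R"
    then show "converges_linearly \<tau> \<sigma> Zs (nat n) (zR (nat n)) (exp (- (1 / real_of_int n) * ln 2))"
      using conv[OF nK] half[of "nat n"] n0 by simp
  next
    show "exp (- m * ln 2) \<le> exp (- (1 / real_of_int n) * ln 2)"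
      using mult_right_mono[OF bounds(1), of "ln 2"] by simp
    show "exp (- (1 / real_of_int n) * ln 2) < exp (- (m / (1 + m)) * ln 2)"
      using mult_strict_right_mono[OF bounds(2), of "ln 2"] by simp
  qed
qed

end
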